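(* Consider the maximum social welfare (MSW) problem with $n$ agents, $m$ items, and weights $a^i_{jk}\ge0$ for all $i\in[m]$, $j,k\in[n]$, normalized so that $\sum_{k=1}^n a^i_{jk}=1$ for all $i,j$. For nondecreasing concave externality functions $f_{ij}:[0,1]\to\mathbb{R}_+$ with $f_{ij}(0)=0$, let $$\beta:=\max_{i,j}\ \sup_{X}\ \frac{f_{ij}(\mathbb{E}[X])}{\mathbb{E}[f_{ij}(X)]},$$ where the supremum is over all random variables $X\in[0,1]$. Then the MSW problem $$\max_{S_1,\dots,S_m}\ \sum_{i=1}^m\sum_{j\in S_i}f_{ij}\Big(\sum_{k\in S_i}a^i_{jk}\Big),$$ the maximum being over all feasible allocations, admits a $4\beta$-approximation algorithm.
   Context: Write $[n]=\{1,\dots,n\}$ (agents) and $[m]=\{1,\dots,m\}$ (items). A feasible allocation is a tuple $(S_1,\dots,S_m)$ of pairwise disjoint (possibly empty) subsets of $[n]$; $S_i$ is the set of agents receiving item $i$. A $\rho$-approximation algorithm is a (possibly randomized) polynomial-time algorithm that on every instance returns a feasible allocation whose expected social welfare is at least $\frac1\rho$ times the maximum social welfare over feasible allocations. In the definition of $\beta$ the ratio $0/0$ is read as $1$; if $\beta=\infty$ the claim is vacuous. *)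

theory Defs
  imports "HOL-Probability.Probability" "HOL-Computational_Algebra.Polynomial"
begin

section \<open>Maximum social welfare\<close>

text \<open>Agents are \<open>{1..agents I}\<close> and items \<open>{1..items I}\<close>; \<open>weight I i j k\<close> is $a^i_{jk}$ and
  \<open>ext I i j\<close> is $f_{ij}$. Values at other indices, and values of \<open>ext I i j\<close> outside \<open>{0..1}\<close>,
  are junk that nothing below depends on.\<close>

record msw_instance =
  agents :: nat
  items  :: nat
  weight :: "nat \<Rightarrow> nat \<Rightarrow> nat \<Rightarrow> real"
  ext    :: "nat \<Rightarrow> nat \<Rightarrow> real \<Rightarrow> real"

definition valid_instance :: "msw_instance \<Rightarrow> bool" where
  "valid_instance I \<longleftrightarrow>
     1 \<le> agents I \<and> 1 \<le> items I \<and>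
     (\<forall>i\<in>{1..items I}. \<forall>j\<in>{1..agents I}.
        (\<forall>k\<in>{1..agents I}. 0 \<le> weight I i j k) \<and>
        (\<Sum>k\<in>{1..agents I}. weight I i j k) = 1 \<and>
        ext I i j \<in> {0..1} \<rightarrow> {0..} \<and>
        mono_on {0..1} (ext I i j) \<and>
        concave_on {0..1} (ext I i j) \<and>
        ext I i j 0 = 0)"

definition feasible :: "msw_instance \<Rightarrow> (nat \<Rightarrow> nat set) \<Rightarrow> bool" where
  "feasible I S \<longleftrightarrow>
     (\<forall>i\<in>{1..items I}. S i \<subseteq> {1..agents I}) \<and> disjoint_family_on S {1..items I}"

definition welfare :: "msw_instance \<Rightarrow> (nat \<Rightarrow> nat set) \<Rightarrow> real" where
  "welfare I S = (\<Sum>i\<in>{1..items I}. \<Sum>j\<in>S i. ext I i j (\<Sum>k\<in>S i. weight I i j k))"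

definition max_welfare :: "msw_instance \<Rightarrow> real" where
  "max_welfare I = Max {welfare I S |S. feasible I S}"

text \<open>The set on the right is nonempty and, since \<open>welfare\<close> only looks at the values of \<open>S\<close> on the
  items, finite, so \<open>Max\<close> is a genuine maximum.\<close>

lemma finite_feasible_welfare: "finite {welfare I S |S. feasible I S}"
proof (rule finite_subset)
  let ?F = "PiE {1..items I} (\<lambda>_. Pow {1..agents I})"
  show "{welfare I S |S. feasible I S} \<subseteq> welfare I ` ?F"
  proof
    fix w assume "w \<in> {welfare I S |S. feasible I S}"
    then obtain S where S: "w = welfare I S" "feasible I S" by blast
    have "welfare I (restrict S {1..items I}) = w"
      unfolding S(1) welfare_def by (intro sum.cong) auto
    moreover have "restrict S {1..items I} \<in> ?F"
      using S(2) by (auto simp: feasible_def)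
    ultimately show "w \<in> welfare I ` ?F" by blast
  qed
  show "finite (welfare I ` ?F)"
    by (intro finite_imageI finite_PiE) auto
qed

lemma feasible_welfare_nonempty: "{welfare I S |S. feasible I S} \<noteq> {}"
proof -
  have "feasible I (\<lambda>_. {})" by (simp add: feasible_def disjoint_family_on_def)
  then show ?thesis by blast
qed

section \<open>The parameter \<open>beta\<close>\<close>

definition ratio :: "real \<Rightarrow> real \<Rightarrow> ereal" where
  "ratio x y = (if x = 0 \<and> y = 0 then 1 else ereal x / ereal y)"

text \<open>The ratio in question depends only on the law of the random variable, a probability measure
  on the reals, and each such law is that of the identity on a sample space of type \<open>real\<close>. Sample
  spaces of type \<open>real\<close> therefore cover all random variables.\<close>

definition jensen_ratio :: "(real \<Rightarrow> real) \<Rightarrow> ereal" where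
  "jensen_ratio g =
     Sup {ratio (g (integral\<^sup>L M X)) (integral\<^sup>L M (\<lambda>\<omega>. g (X \<omega>))) |(M :: real measure) X.
            prob_space M \<and> X \<in> borel_measurable M \<and> X \<in> space M \<rightarrow> {0..1}}"

definition beta :: "msw_instance \<Rightarrow> ereal" where
  "beta I = Max {jensen_ratio (ext I i j) |i j. i \<in> {1..items I} \<and> j \<in> {1..agents I}}"

section \<open>Randomized algorithms\<close>

text \<open>The data of an instance are real numbers and real functions, so algorithms are programs of a
  randomized real RAM: every elementary command costs one step, real arithmetic
  (\<open>+\<close>, \<open>-\<close>, \<open>*\<close>, \<open>/\<close>) and comparison are exact, and the externality functions are given by value
  oracles. There is no rounding of reals to integers, and natural numbers can only be added,
  subtracted and compared; the well-known ways to abuse unit-cost arithmetic with integer division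
  or bit operations are thus unavailable. A program is a finite piece of syntax that
  does not depend on the instance, so charging one step per command, whatever the size of its
  expressions, only affects constants.\<close>

text \<open>Memory cells are addressed by an array name and a list of indices; a scalar variable is a cell
  with an empty list of indices.\<close>

datatype nexp =
    Num nat
  | Agents
  | Items
  | NCell string "nexp list"
  | NPlus nexp nexp
  | NMinus nexp nexp

datatype rexp =
    RNat nexp
  | RCell string "nexp list"
  | RPlus rexp rexp
  | RMinus rexp rexp
  | RTimes rexp rexp
  | RDiv rexp rexp
  | Weight nexp nexp nexp
  | Ext nexp nexp rexp

datatype bexp =
    NLess nexp nexp
  | RLess rexp rexp
  | BNot bexp
  | BAnd bexp bexp

text \<open>\<open>Flip x es\<close> stores the outcome, 0 or 1, of a fair coin flip, independent of all others.
  \<open>Give i j\<close> gives item \<open>i\<close> to agent \<open>j\<close>.\<close>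

datatype com =
    Skip
  | NAssign string "nexp list" nexp
  | RAssign string "nexp list" rexp
  | Flip string "nexp list"
  | Give nexp nexp
  | Seq com com
  | Cond bexp com com
  | While bexp com

record state =
  nats  :: "string \<Rightarrow> nat list \<Rightarrow> nat"
  reals :: "string \<Rightarrow> nat list \<Rightarrow> real"
  alloc :: "nat \<Rightarrow> nat set"

definition initial_state :: state where
  "initial_state = \<lparr>nats = (\<lambda>_ _. 0), reals = (\<lambda>_ _. 0), alloc = (\<lambda>_. {})\<rparr>"

fun nval :: "msw_instance \<Rightarrow> state \<Rightarrow> nexp \<Rightarrow> nat" where
  "nval I s (Num c) = c"
| "nval I s Agents = agents I"
| "nval I s Items = items I"
| "nval I s (NCell x es) = nats s x (map (nval I s) es)"
| "nval I s (NPlus e e') = nval I s e + nval I s e'"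
| "nval I s (NMinus e e') = nval I s e - nval I s e'"

text \<open>Queries for data that are not part of the instance are answered by 0, and so is division
  by 0.\<close>

definition weight_query :: "msw_instance \<Rightarrow> nat \<Rightarrow> nat \<Rightarrow> nat \<Rightarrow> real" where
  "weight_query I i j k =
     (if i \<in> {1..items I} \<and> j \<in> {1..agents I} \<and> k \<in> {1..agents I} then weight I i j k else 0)"

definition ext_query :: "msw_instance \<Rightarrow> nat \<Rightarrow> nat \<Rightarrow> real \<Rightarrow> real" where
  "ext_query I i j x =
     (if i \<in> {1..items I} \<and> j \<in> {1..agents I} \<and> x \<in> {0..1} then ext I i j x else 0)"

fun rval :: "msw_instance \<Rightarrow> state \<Rightarrow> rexp \<Rightarrow> real" where
  "rval I s (RNat e) = real (nval I s e)"
| "rval I s (RCell x es) = reals s x (map (nval I s) es)"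
| "rval I s (RPlus e e') = rval I s e + rval I s e'"
| "rval I s (RMinus e e') = rval I s e - rval I s e'"
| "rval I s (RTimes e e') = rval I s e * rval I s e'"
| "rval I s (RDiv e e') = rval I s e / rval I s e'"
| "rval I s (Weight i j k) = weight_query I (nval I s i) (nval I s j) (nval I s k)"
| "rval I s (Ext i j e) = ext_query I (nval I s i) (nval I s j) (rval I s e)"

fun bval :: "msw_instance \<Rightarrow> state \<Rightarrow> bexp \<Rightarrow> bool" where
  "bval I s (NLess e e') \<longleftrightarrow> nval I s e < nval I s e'"
| "bval I s (RLess e e') \<longleftrightarrow> rval I s e < rval I s e'"
| "bval I s (BNot b) \<longleftrightarrow> \<not> bval I s b"
| "bval I s (BAnd b b') \<longleftrightarrow> bval I s b \<and> bval I s b'"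

definition set_cell :: "(string \<Rightarrow> nat list \<Rightarrow> 'v) \<Rightarrow> string \<Rightarrow> nat list \<Rightarrow> 'v
    \<Rightarrow> string \<Rightarrow> nat list \<Rightarrow> 'v" where
  "set_cell \<sigma> x ix v = \<sigma>(x := (\<sigma> x)(ix := v))"

text \<open>One step of computation: a configuration yields a distribution on successor configurations.
  A configuration \<open>(Skip, s)\<close> is halted and stays as it is.\<close>

fun step :: "msw_instance \<Rightarrow> com \<times> state \<Rightarrow> (com \<times> state) pmf" where
  "step I (Skip, s) = return_pmf (Skip, s)"
| "step I (NAssign x es e, s) =
     return_pmf (Skip, s\<lparr>nats := set_cell (nats s) x (map (nval I s) es) (nval I s e)\<rparr>)"
| "step I (RAssign x es e, s) =
     return_pmf (Skip, s\<lparr>reals := set_cell (reals s) x (map (nval I s) es) (rval I s e)\<rparr>)"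
| "step I (Flip x es, s) =
     map_pmf (\<lambda>b. (Skip, s\<lparr>nats := set_cell (nats s) x (map (nval I s) es) (of_bool b)\<rparr>))
       (bernoulli_pmf (1 / 2))"
| "step I (Give i j, s) =
     return_pmf (Skip, s\<lparr>alloc := (alloc s)
       (nval I s i := insert (nval I s j) (alloc s (nval I s i)))\<rparr>)"
| "step I (Seq c d, s) =
     (if c = Skip then return_pmf (d, s)
      else map_pmf (\<lambda>(c', s'). (Seq c' d, s')) (step I (c, s)))"
| "step I (Cond b c d, s) = return_pmf (if bval I s b then c else d, s)"
| "step I (While b c, s) =
     return_pmf (if bval I s b then Seq c (While b c) else Skip, s)"

primrec steps :: "msw_instance \<Rightarrow> nat \<Rightarrow> com \<times> state \<Rightarrow> (com \<times> state) pmf" where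
  "steps I 0 cfg = return_pmf cfg"
| "steps I (Suc t) cfg = bind_pmf (step I cfg) (steps I t)"

definition run :: "msw_instance \<Rightarrow> com \<Rightarrow> nat \<Rightarrow> (com \<times> state) pmf" where
  "run I P t = steps I t (P, initial_state)"

definition halts_within :: "msw_instance \<Rightarrow> com \<Rightarrow> nat \<Rightarrow> bool" where
  "halts_within I P t \<longleftrightarrow> (\<forall>(c, s)\<in>set_pmf (run I P t). c = Skip)"

text \<open>Polynomial time means that the number of steps is bounded, for all outcomes of the coin flips,
  by a polynomial in the numbers of agents and items; the number of weights is itself polynomial in
  these. The factor \<open>\<rho>\<close> may depend on the instance, as \<open>4 * beta I\<close> does. If \<open>\<rho> I = \<infinity>\<close>, then
  \<open>1 / \<rho> I = 0\<close> and the bound on the welfare is vacuous.\<close>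

definition approximation_algorithm :: "(msw_instance \<Rightarrow> ereal) \<Rightarrow> com \<Rightarrow> bool" where
  "approximation_algorithm \<rho> P \<longleftrightarrow>
     (\<exists>p :: nat poly. \<forall>I. valid_instance I \<longrightarrow>
        (let t = poly p (agents I + items I) in
           halts_within I P t \<and>
           (\<forall>(c, s)\<in>set_pmf (run I P t). feasible I (alloc s)) \<and>
           1 / \<rho> I * ereal (max_welfare I)
             \<le> ereal (measure_pmf.expectation (run I P t) (\<lambda>(c, s). welfare I (alloc s)))))"

end

theory Submission
  imports Defs
begin

text \<open>For a nondecreasing concave \<open>f\<close> with \<open>f 0 = 0\<close>, concavity gives \<open>x * f 1 \<le> f x\<close>, and testing
  \<open>beta\<close> on a random variable with values in \<open>{0, 1}\<close> gives \<open>f x \<le> beta * x * f 1\<close>. Up to the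
  factor \<open>beta\<close> the welfare is therefore the total weight \<open>w i j k = f_ij(1) * a^i_jk\<close> of the pairs
  of agents holding the same item \<open>i\<close>, and it remains to find a 4-approximation for pair weights.

  This is done by a deterministic local search over labellings of the agents by items. Let the price
  of an agent be the weight that it shares with the agents of the same label, so that the prices add
  up to \<open>2 * L\<close>, where \<open>L\<close> is the current value. Relabelling a set \<open>R\<close> by \<open>i\<close> gains at least the
  \<open>i\<close>-weight inside \<open>R\<close> minus the price of \<open>R\<close>. The sets tried are the cores that remain after
  repeatedly discarding agents whose degree in the remaining set is below \<open>l\<close> times their price, for
  \<open>l = 2\<close> and \<open>l = 2 - 1 / m\<close>. If \<open>g\<close> is the best gain, the optimum is at most
  \<open>m * g + (4 - 1 / m) * L\<close>, so as long as \<open>4 * L\<close> is below the optimum, a round gains a fraction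
  \<open>1 / (4 * m^2)\<close> of the optimum, and \<open>m^2\<close> rounds suffice.\<close>

section \<open>Peeling\<close>

definition pair_weight :: "(nat \<Rightarrow> nat \<Rightarrow> real) \<Rightarrow> nat set \<Rightarrow> real" where
  "pair_weight u S = (\<Sum>j\<in>S. \<Sum>k\<in>S. u j k)"

text \<open>\<open>u\<close> need not be symmetric, so both orders of a pair are added; for
  \<open>j\<close> in \<open>S\<close> the entry \<open>u j j\<close> counts twice.\<close>

definition degree_in :: "(nat \<Rightarrow> nat \<Rightarrow> real) \<Rightarrow> nat set \<Rightarrow> nat \<Rightarrow> real" where
  "degree_in u S j = (\<Sum>k\<in>S. u j k + u k j)"

lemma pair_weight_split:
  assumes "finite R" "A \<subseteq> R"
  shows "pair_weight u R = pair_weight u A + (\<Sum>j\<in>A. \<Sum>k\<in>R - A. u j k)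
    + (\<Sum>j\<in>R - A. \<Sum>k\<in>A. u j k) + pair_weight u (R - A)"
proof -
  have split: "(\<Sum>k\<in>R. g k) = (\<Sum>k\<in>A. g k) + (\<Sum>k\<in>R - A. g k)" for g :: "nat \<Rightarrow> real"
    using sum.subset_diff[OF assms(2,1), of g] by simp
  show ?thesis
    unfolding pair_weight_def by (simp add: split sum.distrib)
qed

text \<open>The degrees of the agents in \<open>R - A\<close> count a pair joining \<open>A\<close>
  and \<open>R - A\<close> once and a pair inside \<open>R - A\<close> twice. Half of their sum is
  thus at most what \<open>R\<close> adds to \<open>A\<close>, and the full sum at least that. The
  first bound serves \<open>core_gain\<close>, the second \<open>peel_pass_charge\<close>.\<close>

lemma pair_weight_add_degrees:
  assumes "finite R" "A \<subseteq> R" and nonneg: "\<And>j k. 0 \<le> u j k"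
  shows "pair_weight u A + (\<Sum>j\<in>R - A. degree_in u R j) / 2 \<le> pair_weight u R"
    and "pair_weight u R \<le> pair_weight u A + (\<Sum>j\<in>R - A. degree_in u R j)"
proof -
  have split: "(\<Sum>k\<in>R. g k) = (\<Sum>k\<in>A. g k) + (\<Sum>k\<in>R - A. g k)" for g :: "nat \<Rightarrow> real"
    using sum.subset_diff[OF assms(2,1), of g] by simp
  have "(\<Sum>j\<in>R - A. \<Sum>k\<in>R. u k j) = (\<Sum>k\<in>R. \<Sum>j\<in>R - A. u k j)"
    by (rule sum.swap)
  also have "\<dots> = (\<Sum>k\<in>A. \<Sum>j\<in>R - A. u k j) + pair_weight u (R - A)"
    by (simp add: split pair_weight_def)
  finally have "(\<Sum>j\<in>R - A. degree_in u R j)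
      = (\<Sum>j\<in>A. \<Sum>k\<in>R - A. u j k) + (\<Sum>j\<in>R - A. \<Sum>k\<in>A. u j k) + 2 * pair_weight u (R - A)"
    unfolding degree_in_def by (simp add: sum.distrib) (simp add: split sum.distrib pair_weight_def)
  moreover have "0 \<le> pair_weight u (R - A)" "0 \<le> (\<Sum>j\<in>A. \<Sum>k\<in>R - A. u j k)"
    "0 \<le> (\<Sum>j\<in>R - A. \<Sum>k\<in>A. u j k)"
    unfolding pair_weight_def by (intro sum_nonneg nonneg)+
  ultimately show "pair_weight u A + (\<Sum>j\<in>R - A. degree_in u R j) / 2 \<le> pair_weight u R"
    and "pair_weight u R \<le> pair_weight u A + (\<Sum>j\<in>R - A. degree_in u R j)"
    using pair_weight_split[OF assms(1,2), of u] by linarith+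
qed

lemma degree_in_mono:
  assumes "finite R" "A \<subseteq> R" "\<And>j k. 0 \<le> u j k"
  shows "degree_in u A j \<le> degree_in u R j"
  unfolding degree_in_def by (intro sum_mono2 assms add_nonneg_nonneg)

section \<open>Peeling passes and the core\<close>

primrec peel_pass :: "(nat \<Rightarrow> nat \<Rightarrow> real) \<Rightarrow> (nat \<Rightarrow> real) \<Rightarrow> nat \<Rightarrow> nat set \<Rightarrow> nat set" where
  "peel_pass u c 0 R = R"
| "peel_pass u c (Suc k) R = peel_pass u c k R
     - (if degree_in u (peel_pass u c k R) (Suc k) < c (Suc k) then {Suc k} else {})"

text \<open>A pass tests the agents in turn against what is left at that moment. \<open>n\<close>
  passes reach a fixed point, because a pass that changes the set discards at least one
  agent.\<close>

definition core :: "(nat \<Rightarrow> nat \<Rightarrow> real) \<Rightarrow> (nat \<Rightarrow> real) \<Rightarrow> nat \<Rightarrow> nat set" where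
  "core u c n = (peel_pass u c n ^^ n) {1..n}"

lemma peel_pass_subset: "peel_pass u c k R \<subseteq> R"
  by (induction k) auto

lemma peel_pass_fixed:
  assumes "peel_pass u c k R = R" "j \<in> R" "j \<in> {1..k}"
  shows "c j \<le> degree_in u R j"
  using assms
proof (induction k)
  case (Suc k)
  have "peel_pass u c k R = R"
    using Suc.prems(1) peel_pass_subset[of u c k R] by auto
  with Suc show ?case
    by (cases "j = Suc k") (auto split: if_splits)
qed simp

lemma peel_pass_stable:
  assumes "\<And>j. j \<in> R \<Longrightarrow> c j \<le> degree_in u R j"
  shows "peel_pass u c k R = R"
  by (induction k) (use assms in \<open>force simp: not_less\<close>)+

lemma core_subset: "core u c n \<subseteq> {1..n}"
proof -
  have "(peel_pass u c n ^^ t) R \<subseteq> R" for t R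
    by (induction t) (auto dest: peel_pass_subset[THEN subsetD])
  then show ?thesis by (simp add: core_def)
qed

lemma core_degree:
  assumes "j \<in> core u c n"
  shows "c j \<le> degree_in u (core u c n) j"
proof -
  define R where "R t = (peel_pass u c n ^^ t) {1..n}" for t
  have R_Suc: "R (Suc t) = peel_pass u c n (R t)" for t by (simp add: R_def)
  have fin: "R t \<subseteq> {1..n}" for t
    by (induction t) (auto simp: R_def dest: peel_pass_subset[THEN subsetD])
  \<comment> \<open>While the passes still discard agents, each lowers the cardinality by at least
    one. At \<open>t = n\<close> the first alternative leaves only the empty set, for which the
    claim is vacuous.\<close>
  have "card (R t) + t \<le> n \<or> (\<forall>j\<in>R t. c j \<le> degree_in u (R t) j)" for t
  proof (induction t)
    case 0
    then show ?case by (simp add: R_def)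
  next
    case (Suc t)
    show ?case
    proof (cases "peel_pass u c n (R t) = R t")
      case True
      then show ?thesis
        using peel_pass_fixed[OF True] fin[of t] by (auto simp: R_Suc)
    next
      case False
      then have "card (R (Suc t)) < card (R t)"
        using fin[of t] peel_pass_subset[of u c n "R t"]
        by (intro psubset_card_mono) (auto simp: R_Suc intro: finite_subset)
      \<comment> \<open>A set meeting all thresholds would be fixed by the pass, so the induction
        hypothesis must hold through its first alternative.\<close>
      moreover have "\<not> (\<forall>j\<in>R t. c j \<le> degree_in u (R t) j)"
        using False peel_pass_stable[of "R t" c u n] by blast
      ultimately show ?thesis using Suc by linarith
    qed
  qed
  from this[of n] show ?thesis
    using assms fin[of n] finite_subset[OF fin[of n]] by (auto simp: core_def R_def)
qed

text \<open>When an agent of \<open>S\<close> is discarded, its degree within the remaining part of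
  \<open>S\<close> is at most its degree in the whole remaining set, which is below its threshold.
  Its removal therefore costs \<open>S\<close> at most \<open>c j\<close>, and the removal of agents
  outside \<open>S\<close> costs nothing.\<close>

lemma peel_pass_charge:
  assumes "finite S" and nonneg: "\<And>j k. 0 \<le> u j k" "\<And>j. 0 \<le> c j"
    and "finite R"
  shows "pair_weight u (S \<inter> R)
    \<le> pair_weight u (S \<inter> peel_pass u c k R) + (\<Sum>j\<in>S \<inter> (R - peel_pass u c k R). c j)"
proof (induction k)
  case (Suc k)
  define Q where "Q = peel_pass u c k R"
  have QR: "Q \<subseteq> R" unfolding Q_def by (rule peel_pass_subset)
  show ?case
  proof (cases "degree_in u Q (Suc k) < c (Suc k) \<and> Suc k \<in> S \<inter> Q")
    case True
    let ?j = "Suc k"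
    have eq: "peel_pass u c (Suc k) R = Q - {?j}" using True by (simp add: Q_def)
    have "pair_weight u (S \<inter> Q)
        \<le> pair_weight u (S \<inter> Q - {?j}) + (\<Sum>j\<in>(S \<inter> Q) - (S \<inter> Q - {?j}). degree_in u (S \<inter> Q) j)"
      using assms by (intro pair_weight_add_degrees) auto
    also have "(S \<inter> Q) - (S \<inter> Q - {?j}) = {?j}" using True by auto
    also have "(\<Sum>j\<in>{?j}. degree_in u (S \<inter> Q) j) \<le> degree_in u Q ?j"
      using assms QR by (auto intro!: degree_in_mono intro: finite_subset)
    also have "\<dots> \<le> c ?j" using True by simp
    also have "S \<inter> Q - {?j} = S \<inter> (Q - {?j})" by auto
    finally have "pair_weight u (S \<inter> Q) \<le> pair_weight u (S \<inter> (Q - {?j})) + c ?j" by simp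
    moreover have "S \<inter> (R - (Q - {?j})) = insert ?j (S \<inter> (R - Q))"
      using True QR by auto
    then have "(\<Sum>j\<in>S \<inter> (R - (Q - {?j})). c j) = c ?j + (\<Sum>j\<in>S \<inter> (R - Q). c j)"
      using True assms by simp
    ultimately show ?thesis using Suc.IH unfolding eq Q_def[symmetric] by linarith
  next
    case False
    then have "S \<inter> peel_pass u c (Suc k) R = S \<inter> Q"
      "S \<inter> (R - peel_pass u c (Suc k) R) = S \<inter> (R - Q)"
      by (auto simp: Q_def)
    then show ?thesis using Suc.IH by (simp add: Q_def)
  qed
qed simp

text \<open>The charges of the passes add up, as the agents discarded in different passes are
  distinct.\<close>

lemma core_charge:
  assumes "S \<subseteq> {1..n}" and nonneg: "\<And>j k. 0 \<le> u j k" "\<And>j. 0 \<le> c j"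
  shows "pair_weight u S
    \<le> pair_weight u (S \<inter> core u c n) + (\<Sum>j\<in>S - core u c n. c j)"
proof -
  have fS: "finite S" using assms(1) finite_subset by blast
  define R where "R t = (peel_pass u c n ^^ t) {1..n}" for t
  have "pair_weight u S \<le> pair_weight u (S \<inter> R t) + (\<Sum>j\<in>S - R t. c j)
      \<and> R t \<subseteq> {1..n}" for t
  proof (induction t)
    case 0
    have S: "S \<inter> R 0 = S" "S - R 0 = {}" using assms(1) by (auto simp: R_def)
    show ?case unfolding S by (simp add: R_def)
  next
    case (Suc t)
    have sub: "R (Suc t) \<subseteq> R t" using peel_pass_subset by (simp add: R_def)
    have "pair_weight u (S \<inter> R t)
        \<le> pair_weight u (S \<inter> R (Suc t)) + (\<Sum>j\<in>S \<inter> (R t - R (Suc t)). c j)"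
      using peel_pass_charge[of S u c "R t" n] fS nonneg Suc finite_subset[of "R t" "{1..n}"]
      by (simp add: R_def)
    moreover have "S - R (Suc t) = (S - R t) \<union> (S \<inter> (R t - R (Suc t)))"
      using sub by auto
    then have "(\<Sum>j\<in>S - R (Suc t). c j)
        = (\<Sum>j\<in>S - R t. c j) + (\<Sum>j\<in>S \<inter> (R t - R (Suc t)). c j)"
      using fS by (simp only:) (subst sum.union_disjoint, auto)
    ultimately show ?case using Suc sub by auto
  qed
  then show ?thesis by (simp add: R_def core_def)
qed

text \<open>The agents of \<open>R - S\<close> have degree at least
  \<open>(2 - \<delta>) * p j\<close> in the core \<open>R\<close>, so enlarging
  \<open>S \<inter> R\<close> to \<open>R\<close> adds at least half of these amounts. The bound is
  arranged around \<open>pair_weight u R - sum p R\<close>, which relabelling \<open>R\<close> is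
  certain to gain.\<close>

lemma core_gain:
  assumes "S \<subseteq> {1..n}" "\<delta> \<le> 2"
    and nonneg: "\<And>j k. 0 \<le> u j k" "\<And>j. 0 \<le> p j"
  defines "R \<equiv> core u (\<lambda>j. (2 - \<delta>) * p j) n"
  shows "pair_weight u (S \<inter> R)
    \<le> pair_weight u R - sum p R + sum p (S \<inter> R) + \<delta> / 2 * sum p (R - S)"
proof -
  have fin: "finite R" "finite S"
    using core_subset[of u "\<lambda>j. (2 - \<delta>) * p j" n] assms(1) finite_subset by (auto simp: R_def)
  have "(\<Sum>j\<in>R - S. (2 - \<delta>) * p j) \<le> (\<Sum>j\<in>R - S. degree_in u R j)"
    unfolding R_def by (intro sum_mono core_degree) auto
  then have "pair_weight u (S \<inter> R) + (2 - \<delta>) * sum p (R - S) / 2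
      \<le> pair_weight u (S \<inter> R) + (\<Sum>j\<in>R - S. degree_in u R j) / 2"
    by (simp add: sum_distrib_left)
  also have "R - S = R - S \<inter> R" by auto
  also have "pair_weight u (S \<inter> R) + (\<Sum>j\<in>R - S \<inter> R. degree_in u R j) / 2 \<le> pair_weight u R"
    using fin nonneg by (intro pair_weight_add_degrees) auto
  finally have "pair_weight u (S \<inter> R) + (2 - \<delta>) * sum p (R - S \<inter> R) / 2 \<le> pair_weight u R" .
  moreover have "sum p R = sum p (S \<inter> R) + sum p (R - S)"
    using fin(1) by (metis Int_commute sum.Int_Diff)
  moreover have "R - S = R - S \<inter> R" by auto
  ultimately show ?thesis by (simp add: field_simps)
qed

text \<open>Peeling at the threshold \<open>2\<close> alone gives \<open>pair_weight u S \<le> g + 2 * sum p S\<close>. The slightly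
  smaller threshold \<open>2 - \<delta>\<close> improves this by \<open>\<delta>\<close> up to an error of second order in \<open>\<delta>\<close>: the
  weighted average of the two bounds below, with weights \<open>\<delta>\<close> and \<open>1 - \<delta>\<close>, no longer depends on
  how \<open>sum p S\<close> splits between the core and its complement.\<close>

lemma best_core_gain:
  assumes S: "S \<subseteq> {1..n}" and \<delta>: "0 \<le> \<delta>" "\<delta> \<le> 1"
    and nonneg: "\<And>j k. 0 \<le> u j k" "\<And>j. 0 \<le> p j"
    and total: "sum p {1..n} \<le> 2 * L"
    and g: "\<And>\<epsilon>. \<epsilon> \<in> {0, \<delta>} \<Longrightarrow>
      pair_weight u (core u (\<lambda>j. (2 - \<epsilon>) * p j) n) - sum p (core u (\<lambda>j. (2 - \<epsilon>) * p j) n) \<le> g"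
  shows "pair_weight u S \<le> g + (2 - \<delta>) * sum p S + \<delta>\<^sup>2 * L"
proof -
  define R where "R \<epsilon> = core u (\<lambda>j. (2 - \<epsilon>) * p j) n" for \<epsilon>
  have fS: "finite S" using S finite_subset by blast
  have R: "R \<epsilon> \<subseteq> {1..n}" for \<epsilon> unfolding R_def by (rule core_subset)
  have charge: "pair_weight u T \<le> pair_weight u (T \<inter> R \<epsilon>) + (2 - \<epsilon>) * sum p (T - R \<epsilon>)"
    if "T \<subseteq> {1..n}" "\<epsilon> \<in> {0, \<delta>}" for T \<epsilon>
    using core_charge[of T n u "\<lambda>j. (2 - \<epsilon>) * p j"] that nonneg \<delta>
    by (auto simp: R_def sum_distrib_left)
  have gain: "pair_weight u (T \<inter> R \<epsilon>) \<le> g + sum p (T \<inter> R \<epsilon>) + \<epsilon> / 2 * sum p (R \<epsilon> - T)"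
    if "T \<subseteq> {1..n}" "\<epsilon> \<in> {0, \<delta>}" for T \<epsilon>
    using core_gain[of T n \<epsilon> u p] that nonneg \<delta> g[OF that(2)] unfolding R_def by auto
  have psplit: "sum p T = sum p (T \<inter> Q) + sum p (T - Q)" if "T \<subseteq> {1..n}" for T Q
    using that finite_subset by (intro sum.Int_Diff) auto
  define y where "y = sum p (S \<inter> R \<delta>)"
  have out: "sum p (S - R \<delta>) = sum p S - y" using psplit[OF S, of "R \<delta>"] by (simp add: y_def)
  have "sum p (R \<delta> - S) \<le> sum p {1..n}"
    using R[of \<delta>] nonneg by (intro sum_mono2) auto
  then have "\<delta> / 2 * sum p (R \<delta> - S) \<le> \<delta> / 2 * (2 * L)"
    using total \<delta> by (intro mult_left_mono) auto
  then have A: "pair_weight u S \<le> g + y + \<delta> * L + (2 - \<delta>) * (sum p S - y)"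
    using charge[OF S, of \<delta>] gain[OF S, of \<delta>] by (simp add: out y_def)
  \<comment> \<open>The part of \<open>S\<close> inside this core is peeled once more, at threshold
    2. Its agents in the second core are charged their price once and the others twice, in total at
    most \<open>2 * y\<close>.\<close>
  have sub: "S \<inter> R \<delta> \<subseteq> {1..n}" using S by auto
  have "0 \<le> sum p (S \<inter> R \<delta> \<inter> R 0)" by (intro sum_nonneg nonneg)
  then have "pair_weight u (S \<inter> R \<delta>) \<le> g + 2 * y"
    using charge[OF sub, of 0] gain[OF sub, of 0] psplit[OF sub, of "R 0"] by (simp add: y_def)
  then have B: "pair_weight u S \<le> g + 2 * y + (2 - \<delta>) * (sum p S - y)"
    using charge[OF S, of \<delta>] by (simp add: out y_def)
  have "\<delta> * pair_weight u S + (1 - \<delta>) * pair_weight u S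
      \<le> \<delta> * (g + y + \<delta> * L + (2 - \<delta>) * (sum p S - y))
        + (1 - \<delta>) * (g + 2 * y + (2 - \<delta>) * (sum p S - y))"
    using A B \<delta> by (intro add_mono mult_left_mono) auto
  then show ?thesis by (simp add: algebra_simps power2_eq_square)
qed

section \<open>Relabelling a core\<close>

definition class_weight :: "(nat \<Rightarrow> nat \<Rightarrow> nat \<Rightarrow> real) \<Rightarrow> (nat \<Rightarrow> nat) \<Rightarrow> nat \<Rightarrow> nat \<Rightarrow> real" where
  "class_weight w x j k = of_bool (x j = x k) * w (x j) j k"

definition label_value :: "nat \<Rightarrow> (nat \<Rightarrow> nat \<Rightarrow> nat \<Rightarrow> real) \<Rightarrow> (nat \<Rightarrow> nat) \<Rightarrow> real" where
  "label_value n w x = pair_weight (class_weight w x) {1..n}"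

definition price :: "nat \<Rightarrow> (nat \<Rightarrow> nat \<Rightarrow> nat \<Rightarrow> real) \<Rightarrow> (nat \<Rightarrow> nat) \<Rightarrow> nat \<Rightarrow> real" where
  "price n w x = degree_in (class_weight w x) {1..n}"

lemma sum_price: "sum (price n w x) {1..n} = 2 * label_value n w x"
proof -
  have "(\<Sum>j\<in>{1..n}. \<Sum>k\<in>{1..n}. class_weight w x k j) = label_value n w x"
    unfolding label_value_def pair_weight_def by (rule sum.swap)
  then show ?thesis
    by (simp add: price_def degree_in_def sum.distrib label_value_def pair_weight_def)
qed

definition moved :: "nat \<Rightarrow> (nat \<Rightarrow> nat) \<Rightarrow> nat set \<Rightarrow> nat \<Rightarrow> nat" where
  "moved i x R j = (if j \<in> R then i else x j)"

text \<open>This holds pair by pair. A pair inside \<open>R\<close> receives the new weight and has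
  its old weight subtracted twice; a pair with one end in \<open>R\<close> has its old weight
  subtracted once and a nonnegative value afterwards; all other pairs keep their weight.\<close>

lemma label_value_moved:
  assumes "R \<subseteq> {1..n}" and nonneg: "\<And>i j k. 0 \<le> w i j k"
  shows "label_value n w x + pair_weight (w i) R - sum (price n w x) R
    \<le> label_value n w (moved i x R)"
proof -
  let ?N = "{1..n}"
  let ?t = "class_weight w x"
  have restrict: "sum g R = (\<Sum>j\<in>?N. of_bool (j \<in> R) * g j)" for g :: "nat \<Rightarrow> real"
    using assms(1) by (intro sum.mono_neutral_cong_left) auto
  have t: "0 \<le> ?t j k" for j k using nonneg by (simp add: class_weight_def)
  have "(\<Sum>j\<in>?N. \<Sum>k\<in>?N. of_bool (j \<in> R) * ?t k j)
      = (\<Sum>k\<in>?N. \<Sum>j\<in>?N. of_bool (j \<in> R) * ?t k j)"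
    by (rule sum.swap)
  then have pr: "sum (price n w x) R
      = (\<Sum>j\<in>?N. \<Sum>k\<in>?N. of_bool (j \<in> R) * ?t j k + of_bool (k \<in> R) * ?t j k)"
    unfolding restrict by (simp add: price_def degree_in_def sum_distrib_left sum.distrib distrib_left)
  have pw: "pair_weight (w i) R
      = (\<Sum>j\<in>?N. \<Sum>k\<in>?N. of_bool (j \<in> R) * (of_bool (k \<in> R) * w i j k))"
    unfolding pair_weight_def restrict by (simp only: sum_distrib_left)
  have "label_value n w x + pair_weight (w i) R - sum (price n w x) R
      = (\<Sum>j\<in>?N. \<Sum>k\<in>?N. ?t j k + of_bool (j \<in> R) * (of_bool (k \<in> R) * w i j k)
          - (of_bool (j \<in> R) * ?t j k + of_bool (k \<in> R) * ?t j k))"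
    unfolding pr pw by (simp add: label_value_def pair_weight_def sum.distrib sum_subtractf)
  also have "\<dots> \<le> label_value n w (moved i x R)"
    unfolding label_value_def pair_weight_def
    by (intro sum_mono) (use nonneg t in \<open>auto simp: moved_def class_weight_def\<close>)
  finally show ?thesis .
qed

section \<open>The guaranteed gain of one round\<close>

definition candidate ::
  "nat \<Rightarrow> (nat \<Rightarrow> nat \<Rightarrow> nat \<Rightarrow> real) \<Rightarrow> (nat \<Rightarrow> nat) \<Rightarrow> nat \<Rightarrow> real \<Rightarrow> nat \<Rightarrow> nat" where
  "candidate n w x i l = moved i x (core (w i) (\<lambda>j. l * price n w x j) n)"

definition packing_value :: "nat \<Rightarrow> (nat \<Rightarrow> nat \<Rightarrow> nat \<Rightarrow> real) \<Rightarrow> (nat \<Rightarrow> nat set) \<Rightarrow> real" where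
  "packing_value m w S = (\<Sum>i\<in>{1..m}. pair_weight (w i) (S i))"

text \<open>Adds up \<open>best_core_gain\<close> over the items, with
  \<open>B - label_value n w x\<close> as the gain. Since the sets \<open>S i\<close> are disjoint,
  their prices together are at most \<open>2 * label_value n w x\<close>.\<close>

lemma local_search_step:
  assumes m: "1 \<le> m" and S: "\<And>i. i \<in> {1..m} \<Longrightarrow> S i \<subseteq> {1..n}" "disjoint_family_on S {1..m}"
    and nonneg: "\<And>i j k. 0 \<le> w i j k"
    and best: "\<And>i l. i \<in> {1..m} \<Longrightarrow> l \<in> {2, 2 - 1 / real m} \<Longrightarrow>
      label_value n w (candidate n w x i l) \<le> B"
  shows "packing_value m w S
    \<le> real m * (B - label_value n w x) + (4 - 1 / real m) * label_value n w x"
proof -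
  define L where "L = label_value n w x"
  define p where "p = price n w x"
  \<comment> \<open>Summed over the items, the coefficient of \<open>L\<close> becomes
    \<open>4 - 2 * \<delta> + m * \<delta>\<^sup>2\<close>. This choice minimizes it, with the value
    \<open>4 - \<delta>\<close>.\<close>
  define \<delta> where "\<delta> = 1 / real m"
  have m\<delta>: "real m * \<delta> = 1" "0 \<le> \<delta>" "\<delta> \<le> 1" using m by (auto simp: \<delta>_def)
  have p: "0 \<le> p j" for j
    unfolding p_def price_def degree_in_def class_weight_def
    using nonneg by (intro sum_nonneg) simp
  have "\<And>i. i \<in> {1..m} \<Longrightarrow> finite (S i)"
    using S(1) finite_subset by blast
  then have union: "(\<Sum>i\<in>{1..m}. sum p (S i)) = sum p (\<Union>i\<in>{1..m}. S i)"
    using S(2) by (intro sum.UNION_disjoint[symmetric]) (auto simp: disjoint_family_on_def)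
  have "pair_weight (w i) (S i) \<le> (B - L) + (2 - \<delta>) * sum p (S i) + \<delta>\<^sup>2 * L" if i: "i \<in> {1..m}" for i
  proof (rule best_core_gain[of "S i" n \<delta> "w i" p])
    show "sum p {1..n} \<le> 2 * L" unfolding p_def L_def sum_price by simp
    fix \<epsilon> assume "\<epsilon> \<in> {0, \<delta>}"
    then have "2 - \<epsilon> \<in> {2, 2 - 1 / real m}" by (auto simp: \<delta>_def)
    from best[OF i this] show "pair_weight (w i) (core (w i) (\<lambda>j. (2 - \<epsilon>) * p j) n)
        - sum p (core (w i) (\<lambda>j. (2 - \<epsilon>) * p j) n) \<le> B - L"
      using label_value_moved[where w = w and R = "core (w i) (\<lambda>j. (2 - \<epsilon>) * p j) n" and x = x and i = i,
          OF core_subset nonneg]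
      by (simp add: candidate_def p_def L_def)
  qed (use S i m\<delta> nonneg p in auto)
  then have "packing_value m w S \<le> (\<Sum>i\<in>{1..m}. (B - L) + (2 - \<delta>) * sum p (S i) + \<delta>\<^sup>2 * L)"
    unfolding packing_value_def by (rule sum_mono)
  also have "\<dots> = real m * (B - L) + (2 - \<delta>) * (\<Sum>i\<in>{1..m}. sum p (S i)) + (real m * \<delta>) * \<delta> * L"
    by (simp add: sum.distrib sum_distrib_left power2_eq_square)
  also note union
  also have "(2 - \<delta>) * sum p (\<Union>i\<in>{1..m}. S i) \<le> (2 - \<delta>) * (2 * L)"
    unfolding L_def sum_price[symmetric] p_def[symmetric]
    using S(1) p m\<delta> by (intro mult_left_mono sum_mono2 UN_least) auto
  finally show ?thesis using m\<delta> by (simp add: L_def \<delta>_def algebra_simps)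
qed

section \<open>Verification of programs\<close>

text \<open>Supports are nonempty, so this says that all coin outcomes lead to the one halted
  configuration \<open>(Skip, s')\<close>. Halted configurations stay put, so \<open>t\<close> is
  only an upper bound on the time.\<close>

definition terminates_in :: "msw_instance \<Rightarrow> nat \<Rightarrow> com \<Rightarrow> state \<Rightarrow> state \<Rightarrow> bool" where
  "terminates_in I t c s s' \<longleftrightarrow> set_pmf (steps I t (c, s)) \<subseteq> {(Skip, s')}"

lemma steps_Skip: "steps I t (Skip, s) = return_pmf (Skip, s)"
  by (induction t) (auto simp: bind_return_pmf)

lemma steps_add: "steps I (t + t') cfg = bind_pmf (steps I t cfg) (steps I t')"
  by (induction t arbitrary: cfg) (auto intro!: bind_pmf_cong simp: bind_return_pmf bind_assoc_pmf)

lemma terminates_in_mono: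
  assumes "terminates_in I t c s s'" "t \<le> t'"
  shows "terminates_in I t' c s s'"
proof -
  obtain d where "t' = t + d" using assms(2) le_Suc_ex by blast
  then show ?thesis using assms(1) by (auto simp: terminates_in_def steps_add steps_Skip dest!: subsetD)
qed

text \<open>The extra unit is the step that drops the finished \<open>Skip\<close> in front of
  \<open>d\<close>.\<close>

lemma terminates_in_Seq:
  assumes "terminates_in I t c s s'" "terminates_in I t' d s' s''"
  shows "terminates_in I (t + t' + 1) (Seq c d) s s''"
  using assms(1)
proof (induction t arbitrary: c s)
  case 0
  then show ?case using assms(2) by (simp add: terminates_in_def bind_return_pmf)
next
  case (Suc t)
  show ?case
  proof (cases "c = Skip")
    case True
    then have "s' = s" using Suc.prems by (simp add: terminates_in_def steps_Skip del: steps.simps)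
    then have "terminates_in I (Suc t + t') d s s''"
      using terminates_in_mono[OF assms(2)] by simp
    then show ?thesis using True by (simp add: terminates_in_def bind_return_pmf)
  next
    case False
    have "terminates_in I t c' s1 s'" if "(c', s1) \<in> set_pmf (step I (c, s))" for c' s1
      using Suc.prems that by (auto simp: terminates_in_def)
    then have "terminates_in I (t + t' + 1) (Seq c' d) s1 s''"
      if "(c', s1) \<in> set_pmf (step I (c, s))" for c' s1
      using Suc.IH that by blast
    then show ?thesis using False by (fastforce simp: terminates_in_def bind_map_pmf)
  qed
qed

lemma terminates_in_Cond:
  assumes "terminates_in I t (if bval I s b then c else d) s s'"
  shows "terminates_in I (t + 1) (Cond b c d) s s'"
  using assms by (simp add: terminates_in_def bind_return_pmf)

lemma terminates_in_While_False:
  assumes "\<not> bval I s b"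
  shows "terminates_in I 1 (While b c) s s"
  using assms by (simp add: terminates_in_def bind_return_pmf)

lemma terminates_in_While_True:
  assumes "bval I s b" "terminates_in I t c s s'" "terminates_in I t' (While b c) s' s''"
  shows "terminates_in I (t + t' + 2) (While b c) s s''"
  using assms(1) terminates_in_Seq[OF assms(2,3)] by (simp add: terminates_in_def bind_return_pmf)

text \<open>Bounds the running time only if every loop is executed at most \<open>K\<close> times.\<close>

fun cost :: "nat \<Rightarrow> com \<Rightarrow> nat" where
  "cost K (Seq c d) = cost K c + cost K d + 1"
| "cost K (Cond b c d) = cost K c + cost K d + 1"
| "cost K (While b c) = K * (cost K c + 2) + 1"
| "cost K _ = 1"

text \<open>For fixed syntax only \<open>K\<close> varies, and each level of loop nesting raises the
  degree by one.\<close>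

lemma cost_poly: "\<exists>p. \<forall>K. cost K c = poly p K"
proof (induction c)
  case (Seq c d)
  then obtain p q where "\<And>K. cost K c = poly p K" "\<And>K. cost K d = poly q K" by blast
  then have "\<forall>K. cost K (Seq c d) = poly (p + q + 1) K" by simp
  then show ?case by blast
next
  case (Cond b c d)
  then obtain p q where "\<And>K. cost K c = poly p K" "\<And>K. cost K d = poly q K" by blast
  then have "\<forall>K. cost K (Cond b c d) = poly (p + q + 1) K" by simp
  then show ?case by blast
next
  case (While b c)
  then obtain p where "\<And>K. cost K c = poly p K" by blast
  then have "\<forall>K. cost K (While b c) = poly ([:0, 1:] * (p + [:2:]) + 1) K" by simp
  then show ?case by blast
qed (auto intro: exI[of _ 1])

section \<open>Frame properties\<close>

fun nats_written :: "com \<Rightarrow> string set" where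
  "nats_written (NAssign x es e) = {x}"
| "nats_written (Flip x es) = {x}"
| "nats_written (Seq c d) = nats_written c \<union> nats_written d"
| "nats_written (Cond b c d) = nats_written c \<union> nats_written d"
| "nats_written (While b c) = nats_written c"
| "nats_written _ = {}"

fun reals_written :: "com \<Rightarrow> string set" where
  "reals_written (RAssign x es e) = {x}"
| "reals_written (Seq c d) = reals_written c \<union> reals_written d"
| "reals_written (Cond b c d) = reals_written c \<union> reals_written d"
| "reals_written (While b c) = reals_written c"
| "reals_written _ = {}"

fun gives :: "com \<Rightarrow> bool" where
  "gives (Give i j) \<longleftrightarrow> True"
| "gives (Seq c d) \<longleftrightarrow> gives c \<or> gives d"
| "gives (Cond b c d) \<longleftrightarrow> gives c \<or> gives d"
| "gives (While b c) \<longleftrightarrow> gives c"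
| "gives _ \<longleftrightarrow> False"

definition unchanged :: "string set \<Rightarrow> string set \<Rightarrow> bool \<Rightarrow> state \<Rightarrow> state \<Rightarrow> bool" where
  "unchanged V U g s s' \<longleftrightarrow> (\<forall>v. v \<notin> V \<longrightarrow> nats s' v = nats s v) \<and>
     (\<forall>v. v \<notin> U \<longrightarrow> reals s' v = reals s v) \<and> (\<not> g \<longrightarrow> alloc s' = alloc s)"

lemma unchanged_trans:
  "unchanged V U g s s' \<Longrightarrow> unchanged V' U' g' s' s'' \<Longrightarrow> unchanged (V \<union> V') (U \<union> U') (g \<or> g') s s''"
  by (auto simp: unchanged_def)

lemma unchanged_mono:
  "unchanged V U g s s' \<Longrightarrow> V \<subseteq> V' \<Longrightarrow> U \<subseteq> U' \<Longrightarrow> (g \<Longrightarrow> g') \<Longrightarrow> unchanged V' U' g' s s'"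
  by (auto simp: unchanged_def)

text \<open>The program left after a step is made of pieces of the original one, so the syntactic
  write sets can only shrink. This carries the frame property through an induction on the number of
  steps.\<close>

lemma step_unchanged:
  assumes "(c', s') \<in> set_pmf (step I (c, s))"
  shows "nats_written c' \<subseteq> nats_written c \<and> reals_written c' \<subseteq> reals_written c \<and>
    (gives c' \<longrightarrow> gives c) \<and> unchanged (nats_written c) (reals_written c) (gives c) s s'"
  using assms
proof (induction c arbitrary: c' s')
  case (Seq c d)
  then show ?case by (cases "c = Skip") (fastforce simp: unchanged_def)+
qed (auto simp: unchanged_def set_cell_def)

lemma terminates_in_unchanged:
  assumes "terminates_in I t c s s'"
  shows "unchanged (nats_written c) (reals_written c) (gives c) s s'"
  using assms
proof (induction t arbitrary: c s)
  case 0
  then show ?case by (simp add: terminates_in_def unchanged_def)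
next
  case (Suc t)
  \<comment> \<open>All outcomes of the step end in the same final state, so it suffices to follow
    one of them.\<close>
  obtain c1 s1 where cs: "(c1, s1) \<in> set_pmf (step I (c, s))"
    using set_pmf_not_empty[of "step I (c, s)"] by (metis ex_in_conv surj_pair)
  then have "terminates_in I t c1 s1 s'" using Suc.prems by (auto simp: terminates_in_def)
  from Suc.IH[OF this] have "unchanged (nats_written c) (reals_written c) (gives c) s1 s'"
    using step_unchanged[OF cs] by (auto intro: unchanged_mono)
  then show ?case
    using unchanged_trans step_unchanged[OF cs] by fastforce
qed

text \<open>Total correctness with the time bound \<open>cost\<close> built in: verifying what a
  program computes bounds its running time as well.\<close>

definition wp :: "msw_instance \<Rightarrow> com \<Rightarrow> (state \<Rightarrow> bool) \<Rightarrow> state \<Rightarrow> bool" where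
  "wp I c Q s \<longleftrightarrow> (\<exists>s'. terminates_in I (cost (agents I + items I) c) c s s' \<and> Q s')"

text \<open>Consequence combined with framing: in weakening a postcondition, all cells that the
  program cannot write may be taken as unchanged.\<close>

lemma wp_conseq:
  assumes "wp I c Q s"
    and "\<And>s'. unchanged (nats_written c) (reals_written c) (gives c) s s' \<Longrightarrow> Q s' \<Longrightarrow> Q' s'"
  shows "wp I c Q' s"
  using assms terminates_in_unchanged unfolding wp_def by blast

lemma wp_Skip: "Q s \<Longrightarrow> wp I Skip Q s"
  by (auto simp: wp_def terminates_in_def steps_Skip simp del: steps.simps)

lemma wp_NAssign:
  "Q (s\<lparr>nats := set_cell (nats s) x (map (nval I s) es) (nval I s e)\<rparr>) \<Longrightarrow> wp I (NAssign x es e) Q s"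
  by (auto simp: wp_def terminates_in_def bind_return_pmf)

lemma wp_RAssign:
  "Q (s\<lparr>reals := set_cell (reals s) x (map (nval I s) es) (rval I s e)\<rparr>) \<Longrightarrow> wp I (RAssign x es e) Q s"
  by (auto simp: wp_def terminates_in_def bind_return_pmf)

lemma wp_Give:
  "Q (s\<lparr>alloc := (alloc s)(nval I s i := insert (nval I s j) (alloc s (nval I s i)))\<rparr>)
    \<Longrightarrow> wp I (Give i j) Q s"
  by (auto simp: wp_def terminates_in_def bind_return_pmf)

lemma wp_Seq: "wp I c (wp I d Q) s \<Longrightarrow> wp I (Seq c d) Q s"
  unfolding wp_def by (auto intro: terminates_in_Seq[simplified])

lemma wp_Cond:
  assumes "bval I s b \<Longrightarrow> wp I c Q s" "\<not> bval I s b \<Longrightarrow> wp I d Q s"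
  shows "wp I (Cond b c d) Q s"
proof -
  obtain s' where s': "terminates_in I (cost (agents I + items I) (if bval I s b then c else d))
      (if bval I s b then c else d) s s'" "Q s'"
    using assms by (cases "bval I s b") (auto simp: wp_def)
  from terminates_in_mono[OF s'(1), of "cost (agents I + items I) c + cost (agents I + items I) d"]
  have "terminates_in I (cost (agents I + items I) c + cost (agents I + items I) d)
      (if bval I s b then c else d) s s'"
    by auto
  from terminates_in_Cond[OF this] show ?thesis
    using s'(2) by (auto simp: wp_def)
qed

text \<open>The counter is raised before the body runs, so the body sees the values from 1 on,
  matching the numbering of agents and items.\<close>

definition For :: "string \<Rightarrow> nexp \<Rightarrow> com \<Rightarrow> com" where
  "For v e c = Seq (NAssign v [] (Num 0)) (While (NLess (NCell v []) e)
     (Seq (NAssign v [] (NPlus (NCell v []) (Num 1))) c))"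

lemma For_written:
  "nats_written (For v e c) = insert v (nats_written c)"
  "reals_written (For v e c) = reals_written c"
  "gives (For v e c) = gives c"
  by (auto simp: For_def)

text \<open>The values of \<open>Agents\<close> and \<open>Items\<close> do not depend on the state
  and are at most \<open>agents I + items I\<close>, the number of executions that
  \<open>cost\<close> allots to a loop. \<open>Inv k\<close> describes the state after
  \<open>k\<close> executions of the body.\<close>

lemma wp_For:
  assumes e: "e = Agents \<or> e = Items" and v: "v \<notin> nats_written c"
    and init: "Inv 0 (s\<lparr>nats := set_cell (nats s) v [] 0\<rparr>)"
    and step: "\<And>k s. k < nval I s e \<Longrightarrow> Inv k s \<Longrightarrow>
      wp I c (Inv (Suc k)) (s\<lparr>nats := set_cell (nats s) v [] (Suc k)\<rparr>)"
    and final: "\<And>s'. Inv (nval I s e) s' \<Longrightarrow> Q s'"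
  shows "wp I (For v e c) Q s"
proof -
  define N where "N = nval I s e"
  define K where "K = agents I + items I"
  define b where "b = NLess (NCell v []) e"
  define d where "d = Seq (NAssign v [] (NPlus (NCell v []) (Num 1))) c"
  have N: "nval I s' e = N" "N \<le> K" for s' using e by (auto simp: N_def K_def)
  \<comment> \<open>By induction on the number \<open>N - k\<close> of remaining executions. Each
    takes the time for \<open>d\<close> and two more steps, for the test and for leaving the
    \<open>Seq\<close>.\<close>
  have loop: "\<exists>s'. terminates_in I ((N - k) * (cost K d + 2) + 1) (While b d) s s' \<and> Inv N s'"
    if "k \<le> N" "nats s v [] = k" "Inv k s" for k s
    using that
  proof (induction "N - k" arbitrary: k s)
    case 0
    then show ?case
      using terminates_in_While_False[of I s b d] by (auto simp: b_def N)
  next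
    case (Suc r)
    let ?s = "s\<lparr>nats := set_cell (nats s) v [] (Suc k)\<rparr>"
    have k: "k < N" using Suc by simp
    have "wp I d (\<lambda>s'. Inv (Suc k) s' \<and> nats s' v [] = Suc k) s"
      unfolding d_def
    proof (intro wp_Seq wp_NAssign)
      have "wp I c (Inv (Suc k)) ?s" using step[of k s] k Suc by (simp add: N)
      then have "wp I c (\<lambda>s'. Inv (Suc k) s' \<and> nats s' v [] = Suc k) ?s"
        by (rule wp_conseq) (use v in \<open>simp add: unchanged_def set_cell_def\<close>)
      then show "wp I c (\<lambda>s'. Inv (Suc k) s' \<and> nats s' v [] = Suc k)
          (s\<lparr>nats := set_cell (nats s) v (map (nval I s) []) (nval I s (NPlus (NCell v []) (Num 1)))\<rparr>)"
        using Suc by simp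
    qed
    then obtain s1 where s1: "terminates_in I (cost K d) d s s1" "Inv (Suc k) s1"
      "nats s1 v [] = Suc k"
      unfolding wp_def K_def by blast
    have "r = N - Suc k" "Suc k \<le> N" using Suc.hyps(2) k by auto
    from Suc.hyps(1)[OF this s1(3,2)] obtain s2 where
      s2: "terminates_in I ((N - Suc k) * (cost K d + 2) + 1) (While b d) s1 s2" "Inv N s2" by blast
    have "bval I s b" using k Suc.prems by (simp add: b_def N)
    from terminates_in_While_True[OF this s1(1) s2(1)]
    have "terminates_in I (Suc (N - Suc k) * (cost K d + 2) + 1) (While b d) s s2"
      by (simp add: algebra_simps)
    moreover have "Suc (N - Suc k) = N - k" using k by simp
    ultimately show ?case using s2(2) by metis
  qed
  show ?thesis
    unfolding For_def b_def[symmetric] d_def[symmetric]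
  proof (intro wp_Seq wp_NAssign)
    let ?s = "s\<lparr>nats := set_cell (nats s) v [] 0\<rparr>"
    obtain s' where s': "terminates_in I ((N - 0) * (cost K d + 2) + 1) (While b d) ?s s'" "Inv N s'"
      using loop[of 0 ?s] init by (auto simp: set_cell_def)
    have "terminates_in I (cost K (While b d)) (While b d) ?s s'"
      using N(2) by (intro terminates_in_mono[OF s'(1)])
        (simp only: cost.simps, intro add_mono mult_right_mono, auto)
    then show "wp I (While b d) Q (s\<lparr>nats := set_cell (nats s) v (map (nval I s) []) (nval I s (Num 0))\<rparr>)"
      using s'(2) final by (auto simp: wp_def K_def N_def)
  qed
qed

definition Sum_to :: "string \<Rightarrow> string \<Rightarrow> rexp \<Rightarrow> com" where
  "Sum_to d k e = Seq (RAssign d [] (RNat (Num 0)))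
     (For k Agents (RAssign d [] (RPlus (RCell d []) e)))"

lemma Sum_to_written:
  "nats_written (Sum_to d k e) = {k}" "reals_written (Sum_to d k e) = {d}" "gives (Sum_to d k e) = False"
  by (auto simp: Sum_to_def For_written)

lemma wp_Sum_to:
  assumes e: "\<And>s' i. i \<in> {1..agents I} \<Longrightarrow> unchanged {k} {d} False s s' \<Longrightarrow> nats s' k [] = i \<Longrightarrow>
      rval I s' e = F i"
    and final: "\<And>s'. unchanged {k} {d} False s s' \<Longrightarrow> reals s' d [] = (\<Sum>i\<in>{1..agents I}. F i) \<Longrightarrow> Q s'"
  shows "wp I (Sum_to d k e) Q s"
  unfolding Sum_to_def
proof (intro wp_Seq wp_RAssign wp_For[where Inv = "\<lambda>i s'. unchanged {k} {d} False s s' \<and>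
    reals s' d [] = (\<Sum>i\<in>{1..i}. F i)"], goal_cases)
  case (4 i s')
  then show ?case
    using e[of "Suc i" "s'\<lparr>nats := set_cell (nats s') k [] (Suc i)\<rparr>"]
    by (simp add: unchanged_def set_cell_def)
qed (use final in \<open>auto simp: unchanged_def set_cell_def\<close>)

lemma wp_map:
  assumes c: "nats_written c \<subseteq> {y}" "reals_written c = {}" "\<not> gives c" "k \<noteq> y"
    and body: "\<And>s' i. i \<in> {1..agents I} \<Longrightarrow> unchanged {k, y} {} False s s' \<Longrightarrow> nats s' k [] = i \<Longrightarrow>
      wp I c (\<lambda>s''. nats s'' y = (nats s' y)([i] := F i)) s'"
    and final: "\<And>s'. unchanged {k, y} {} False s s' \<Longrightarrow>
      (\<And>i. i \<in> {1..agents I} \<Longrightarrow> nats s' y [i] = F i) \<Longrightarrow> Q s'"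
  shows "wp I (For k Agents c) Q s"
proof (rule wp_For[where Inv = "\<lambda>i s'. unchanged {k, y} {} False s s' \<and>
    (\<forall>j\<in>{1..i}. nats s' y [j] = F j)"], goal_cases)
  case (4 i s')
  let ?s = "s'\<lparr>nats := set_cell (nats s') k [] (Suc i)\<rparr>"
  have "wp I c (\<lambda>s''. nats s'' y = (nats ?s y)([Suc i] := F (Suc i))) ?s"
    using 4 by (intro body) (auto simp: unchanged_def set_cell_def)
  then show ?case
  proof (rule wp_conseq, goal_cases)
    case (1 s'')
    have "unchanged {k} {} False s' ?s" by (simp add: unchanged_def set_cell_def)
    moreover have "unchanged {y} {} False ?s s''"
      using 1(1) by (rule unchanged_mono) (use c in auto)
    ultimately have "unchanged {k, y} {} False s s''"
      using 4 by (auto simp: unchanged_def)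
    then show ?case using 1(2) 4 c(4) by (auto simp: set_cell_def le_Suc_eq)
  qed
qed (use c final in \<open>auto simp: unchanged_def set_cell_def\<close>)

section \<open>The local search program\<close>

text \<open>Built from oracle answers, so that it agrees with what a program computes at every index
  and vanishes at labels that are not items.\<close>

definition lin_weight :: "msw_instance \<Rightarrow> nat \<Rightarrow> nat \<Rightarrow> nat \<Rightarrow> real" where
  "lin_weight I i j k = ext_query I i j 1 * weight_query I i j k"

definition Lin_weight :: "nexp \<Rightarrow> nexp \<Rightarrow> nexp \<Rightarrow> rexp" where
  "Lin_weight i j k = RTimes (Ext i j (RNat (Num 1))) (Weight i j k)"

lemma rval_Lin_weight [simp]:
  "rval I s (Lin_weight i j k) = lin_weight I (nval I s i) (nval I s j) (nval I s k)"
  by (simp add: Lin_weight_def lin_weight_def)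

text \<open>Uses that subtraction of natural numbers is truncated.\<close>

definition NEqual :: "nexp \<Rightarrow> nexp \<Rightarrow> rexp" where
  "NEqual e e' = RNat (NMinus (Num 1) (NPlus (NMinus e e') (NMinus e' e)))"

lemma rval_NEqual [simp]: "rval I s (NEqual e e') = of_bool (nval I s e = nval I s e')"
  by (auto simp: NEqual_def)

definition var :: "string \<Rightarrow> nexp" where "var v = NCell v []"
definition entry :: "string \<Rightarrow> string \<Rightarrow> nexp" where "entry v k = NCell v [NCell k []]"

lemma nval_var_entry [simp]:
  "nval I s (var v) = nats s v []" "nval I s (entry v k) = nats s v [nats s k []]"
  by (simp_all add: var_def entry_def)

text \<open>\<open>x\<close> holds the current labelling, \<open>y\<close> the best one found in this round and \<open>z\<close> the candidate
  for item \<open>i\<close>; \<open>r\<close> flags the agents that have not been peeled off. Initially all agents have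
  label 0, which is not an item, so that its weights are answered by 0.\<close>

definition Peel :: "rexp \<Rightarrow> com" where
  "Peel l = For ''a'' Agents (For ''j'' Agents (Seq
     (Sum_to ''d'' ''k'' (RMinus
        (RTimes (RNat (entry ''r'' ''k'')) (RPlus
          (Lin_weight (var ''i'') (var ''j'') (var ''k'')) (Lin_weight (var ''i'') (var ''k'') (var ''j''))))
        (RTimes l (RTimes (NEqual (entry ''x'' ''j'') (entry ''x'' ''k'')) (RPlus
          (Lin_weight (entry ''x'' ''j'') (var ''j'') (var ''k''))
          (Lin_weight (entry ''x'' ''j'') (var ''k'') (var ''j'')))))))
     (Cond (RLess (RCell ''d'' []) (RNat (Num 0))) (NAssign ''r'' [var ''j''] (Num 0)) Skip)))"

definition Class_weight :: "string \<Rightarrow> rexp" where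
  "Class_weight v = RTimes (NEqual (entry v ''j'') (entry v ''k''))
     (Lin_weight (entry v ''j'') (var ''j'') (var ''k''))"

definition Compare :: com where
  "Compare = Seq (RAssign ''d'' [] (RNat (Num 0))) (For ''j'' Agents (Seq
     (Sum_to ''e'' ''k'' (RMinus (Class_weight ''z'') (Class_weight ''y'')))
     (RAssign ''d'' [] (RPlus (RCell ''d'' []) (RCell ''e'' [])))))"

definition Copy :: "string \<Rightarrow> string \<Rightarrow> com" where
  "Copy v v' = For ''j'' Agents (NAssign v [var ''j''] (entry v' ''j''))"

definition Try :: "rexp \<Rightarrow> com" where
  "Try l = Seq (For ''j'' Agents (NAssign ''r'' [var ''j''] (Num 1))) (Seq (Peel l) (Seq
     (For ''j'' Agents (Cond (NLess (Num 0) (entry ''r'' ''j''))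
        (NAssign ''z'' [var ''j''] (var ''i'')) (NAssign ''z'' [var ''j''] (entry ''x'' ''j''))))
     (Seq Compare (Cond (RLess (RNat (Num 0)) (RCell ''d'' [])) (Copy ''y'' ''z'') Skip))))"

text \<open>All candidates of a round are formed from the same \<open>x\<close>, which is
  overwritten only at the end; meanwhile \<open>y\<close> collects the best one.\<close>

definition Round :: com where
  "Round = Seq (Copy ''y'' ''x'') (Seq
     (For ''i'' Items (Seq (Try (RNat (Num 2)))
        (Try (RMinus (RNat (Num 2)) (RDiv (RNat (Num 1)) (RNat Items))))))
     (Copy ''x'' ''y''))"

text \<open>The nested loops make \<open>m * m\<close> rounds out of loops bounded by
  \<open>Items\<close>. An agent still labelled 0 is put into the set at index 0, which is not an
  item, so it receives nothing.\<close>

definition Local_search :: com where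
  "Local_search = Seq (For ''s'' Items (For ''t'' Items Round))
     (For ''j'' Agents (Give (entry ''x'' ''j'') (var ''j'')))"

section \<open>Correctness of the subprograms\<close>

definition labelling :: "string \<Rightarrow> state \<Rightarrow> nat \<Rightarrow> nat" where
  "labelling v s j = nats s v [j]"

definition flags :: "msw_instance \<Rightarrow> state \<Rightarrow> nat set \<Rightarrow> bool" where
  "flags I s R \<longleftrightarrow> (\<forall>k\<in>{1..agents I}. nats s ''r'' [k] = of_bool (k \<in> R))"

lemma label_value_cong:
  "(\<And>j. j \<in> {1..n} \<Longrightarrow> x j = y j) \<Longrightarrow> label_value n w x = label_value n w y"
  by (auto simp: label_value_def pair_weight_def class_weight_def intro!: sum.cong)

lemma Peel_written:
  "nats_written (Peel l) = {''a'', ''j'', ''k'', ''r''}" "reals_written (Peel l) = {''d''}"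
  "\<not> gives (Peel l)"
  by (auto simp: Peel_def For_written Sum_to_written)

text \<open>The outer loop counts passes and the inner one runs through a pass, with
  \<open>r\<close> flagging the current set. At agent \<open>j\<close> the cell \<open>d\<close>
  holds its remaining degree minus its threshold, so testing for a negative value is the test of
  \<open>peel_pass\<close>.\<close>

lemma wp_Peel:
  assumes l: "\<And>s. rval I s l = c" and flags: "flags I s {1..agents I}"
    and final: "\<And>s'. unchanged {''a'', ''j'', ''k'', ''r''} {''d''} False s s' \<Longrightarrow>
      flags I s' (core (lin_weight I (nats s ''i'' []))
        (\<lambda>j. c * price (agents I) (lin_weight I) (labelling ''x'' s) j) (agents I)) \<Longrightarrow> Q s'"
  shows "wp I (Peel l) Q s"
proof -
  define n u x where "n = agents I" and "u = lin_weight I (nats s ''i'' [])" and "x = labelling ''x'' s"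
  define t where "t j = c * price n (lin_weight I) x j" for j
  define R where "R a = (peel_pass u t n ^^ a) {1..n}" for a
  have R: "R a \<subseteq> {1..n}" for a
    by (induction a) (auto simp: R_def dest: peel_pass_subset[THEN subsetD])
  define same where "same = unchanged {''a'', ''j'', ''k'', ''r''} {''d''} False s"
  show ?thesis
    unfolding Peel_def
  proof (rule wp_For[where Inv = "\<lambda>a s'. same s' \<and> flags I s' (R a)"], goal_cases)
    case (4 a s1)
    show ?case
    proof (rule wp_For[where Inv = "\<lambda>j s'. same s' \<and> flags I s' (peel_pass u t j (R a))"], goal_cases)
      case (4 j s2)
      define Q where "Q = peel_pass u t j (R a)"
      have Q: "Q \<subseteq> {1..n}" using R[of a] peel_pass_subset unfolding Q_def by blast
      let ?s = "s2\<lparr>nats := set_cell (nats s2) ''j'' [] (Suc j)\<rparr>"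
      let ?F = "\<lambda>k. of_bool (k \<in> Q) * (u (Suc j) k + u k (Suc j))
        - c * (class_weight (lin_weight I) x (Suc j) k + class_weight (lin_weight I) x k (Suc j))"
      have j: "Suc j \<in> {1..n}" using 4(1) by (simp add: n_def)
      have d: "(\<Sum>k\<in>{1..n}. ?F k) = degree_in u Q (Suc j) - t (Suc j)"
      proof -
        have "degree_in u Q (Suc j) = (\<Sum>k\<in>{1..n}. of_bool (k \<in> Q) * (u (Suc j) k + u k (Suc j)))"
          unfolding degree_in_def using Q by (intro sum.mono_neutral_cong_left) auto
        then show ?thesis
          by (simp only: t_def price_def degree_in_def sum_subtractf sum_distrib_left)
      qed
      show ?case
      proof (intro wp_Seq, rule wp_Sum_to[where F = ?F], goal_cases)
        case (1 s3 k)
        have x: "nats s3 ''x'' [i] = x i" for i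
          using 1(2) 4(2) by (simp add: same_def unchanged_def set_cell_def x_def labelling_def)
        have "nats s3 ''i'' [] = nats s ''i'' []" "nats s3 ''j'' [] = Suc j"
          using 1(2) 4(2) by (simp_all add: same_def unchanged_def set_cell_def)
        moreover have "nats s3 ''r'' [k] = of_bool (k \<in> Q)"
          using 1(1,2) 4(2) by (simp add: flags_def unchanged_def set_cell_def Q_def)
        ultimately show ?case
          using 1(3) by (cases "x (Suc j) = x k") (simp_all add: l x class_weight_def u_def)
      next
        case (2 s3)
        then have d3: "reals s3 ''d'' [] = degree_in u Q (Suc j) - t (Suc j)"
          using d by (simp add: n_def)
        have j3: "nats s3 ''j'' [] = Suc j" and r3: "nats s3 ''r'' = nats s2 ''r''"
          using 2(1) by (simp_all add: unchanged_def set_cell_def)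
        have "same s3"
          using 2(1) 4(2) by (simp add: same_def unchanged_def set_cell_def)
        then have "same (s3\<lparr>nats := set_cell (nats s3) ''r'' ix v\<rparr>)" "same s3" for ix v
          by (simp_all add: same_def unchanged_def set_cell_def)
        moreover have "\<forall>k\<in>{1..agents I}. nats s3 ''r'' [k] = of_bool (k \<in> Q)"
          using 4(2) by (simp add: r3 flags_def Q_def)
        ultimately show ?case
          by (intro wp_Cond wp_NAssign wp_Skip)
            (simp_all add: d3 j3 flags_def Q_def[symmetric] set_cell_def)
      qed
    qed (use 4 in \<open>auto simp: same_def unchanged_def set_cell_def flags_def For_written
        Sum_to_written R_def n_def\<close>)
  next
    case (5 s1)
    then show ?case
      using final[of s1] by (simp add: same_def R_def core_def n_def u_def x_def t_def[abs_def])
  qed (use flags in \<open>auto simp: same_def unchanged_def set_cell_def flags_def For_written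
        Sum_to_written R_def n_def\<close>)
qed

lemma Compare_written:
  "nats_written Compare = {''j'', ''k''}" "reals_written Compare = {''d'', ''e''}"
  "\<not> gives Compare"
  by (auto simp: Compare_def For_written Sum_to_written)

lemma wp_Compare:
  assumes final: "\<And>s'. unchanged {''j'', ''k''} {''d'', ''e''} False s s' \<Longrightarrow>
      reals s' ''d'' [] = label_value (agents I) (lin_weight I) (labelling ''z'' s)
        - label_value (agents I) (lin_weight I) (labelling ''y'' s) \<Longrightarrow> Q s'"
  shows "wp I Compare Q s"
proof -
  define n where "n = agents I"
  define F where "F j k = class_weight (lin_weight I) (labelling ''z'' s) j k
    - class_weight (lin_weight I) (labelling ''y'' s) j k" for j k
  define same where "same = unchanged {''j'', ''k''} {''d'', ''e''} False s"
  show ?thesis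
    unfolding Compare_def
  proof (intro wp_Seq wp_RAssign, rule wp_For[where Inv = "\<lambda>i s'. same s' \<and>
      reals s' ''d'' [] = (\<Sum>j\<in>{1..i}. \<Sum>k\<in>{1..n}. F j k)"], goal_cases)
    case (4 j s1)
    show ?case
    proof (intro wp_Seq, rule wp_Sum_to[where F = "F (Suc j)"], goal_cases)
      case (1 s2 k)
      then show ?case
        using 4 by (auto simp: same_def unchanged_def set_cell_def F_def class_weight_def
          labelling_def Class_weight_def)
    next
      case (2 s2)
      then show ?case
        using 4 by (intro wp_RAssign) (auto simp: same_def unchanged_def set_cell_def n_def)
    qed
  next
    case (5 s1)
    then show ?case
      using final[of s1]
      by (simp add: same_def n_def F_def label_value_def pair_weight_def sum_subtractf)
  qed (auto simp: same_def unchanged_def set_cell_def For_written Sum_to_written)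
qed

lemma Copy_written:
  "nats_written (Copy v v') = {''j'', v}" "reals_written (Copy v v') = {}" "\<not> gives (Copy v v')"
  by (auto simp: Copy_def For_written)

lemma wp_Copy:
  assumes "v \<noteq> ''j''" "v' \<noteq> ''j''" "v \<noteq> v'"
    and final: "\<And>s'. unchanged {''j'', v} {} False s s' \<Longrightarrow>
      (\<And>j. j \<in> {1..agents I} \<Longrightarrow> labelling v s' j = labelling v' s j) \<Longrightarrow> Q s'"
  shows "wp I (Copy v v') Q s"
  unfolding Copy_def
proof (rule wp_map[where y = v and F = "labelling v' s"], goal_cases)
  case (5 s' i)
  then show ?case
    using assms(1-3) by (intro wp_NAssign) (auto simp: unchanged_def set_cell_def labelling_def)
next
  case (6 s')
  then show ?case using final[of s'] by (simp add: labelling_def)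
qed (use assms in auto)

lemma Try_written:
  "nats_written (Try l) = {''a'', ''j'', ''k'', ''r'', ''y'', ''z''}"
  "reals_written (Try l) = {''d'', ''e''}" "\<not> gives (Try l)"
  by (auto simp: Try_def For_written Peel_written Compare_written Copy_written)

text \<open>Which labelling \<open>y\<close> ends up with is left open; the analysis of a round uses
  only that it is no worse than the old \<open>y\<close> and the candidate.\<close>

lemma wp_Try:
  fixes I s
  defines "V \<equiv> label_value (agents I) (lin_weight I)"
  assumes l: "\<And>s. rval I s l = c"
    and final: "\<And>s'. unchanged {''a'', ''j'', ''k'', ''r'', ''y'', ''z''} {''d'', ''e''} False s s' \<Longrightarrow>
      V (labelling ''y'' s) \<le> V (labelling ''y'' s') \<Longrightarrow>
      V (candidate (agents I) (lin_weight I) (labelling ''x'' s) (nats s ''i'' []) c)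
        \<le> V (labelling ''y'' s') \<Longrightarrow> Q s'"
  shows "wp I (Try l) Q s"
proof -
  define n i x where "n = agents I" and "i = nats s ''i'' []" and "x = labelling ''x'' s"
  define R where "R = core (lin_weight I i) (\<lambda>j. c * price n (lin_weight I) x j) n"
  define z where "z = candidate n (lin_weight I) x i c"
  define W where "W = {''a'', ''j'', ''k'', ''r'', ''y'', ''z''}"
  define same where "same = unchanged W {''d'', ''e''} False s"
  have same_trans: "same s2" if "same s1" "unchanged W' U False s1 s2" "W' \<subseteq> W" "U \<subseteq> {''d'', ''e''}"
    for s1 s2 W' U
    using that unfolding same_def unchanged_def by (metis (no_types, opaque_lifting) subsetD)
  have same_s: "same s" by (simp add: same_def unchanged_def)
  have sameD: "nats s' ''x'' = nats s ''x''" "nats s' ''i'' = nats s ''i''" if "same s'" for s'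
    using that by (auto simp: same_def unchanged_def W_def)
  \<comment> \<open>The tail of the program, once \<open>z\<close> is filled: \<open>d\<close>
    becomes the value of \<open>z\<close> minus that of \<open>y\<close>, so \<open>y\<close> is
    overwritten exactly if the candidate is strictly better.\<close>
  have *: "wp I (Seq Compare (Cond (RLess (RNat (Num 0)) (RCell ''d'' [])) (Copy ''y'' ''z'') Skip)) Q s3"
    if s3: "same s3" "nats s3 ''y'' = nats s ''y''" "\<And>j. j \<in> {1..n} \<Longrightarrow> labelling ''z'' s3 j = z j" for s3
  proof (intro wp_Seq wp_Compare)
    fix s4
    assume s4: "unchanged {''j'', ''k''} {''d'', ''e''} False s3 s4"
      "reals s4 ''d'' [] = label_value (agents I) (lin_weight I) (labelling ''z'' s3)
        - label_value (agents I) (lin_weight I) (labelling ''y'' s3)"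
    have same4: "same s4" using s3(1) s4(1) by (rule same_trans) (auto simp: W_def)
    have "V (labelling ''z'' s3) = V z"
      unfolding V_def by (rule label_value_cong) (use s3(3) in \<open>simp add: n_def\<close>)
    moreover have "labelling ''z'' s4 = labelling ''z'' s3"
      using s4(1) by (simp add: unchanged_def labelling_def[abs_def])
    ultimately have z: "V (labelling ''z'' s4) = V z" "V (labelling ''z'' s3) = V z" by simp_all
    have y: "labelling ''y'' s4 = labelling ''y'' s" "labelling ''y'' s3 = labelling ''y'' s"
      using s3(2) s4(1) by (simp_all add: labelling_def[abs_def] unchanged_def)
    have d: "reals s4 ''d'' [] = V z - V (labelling ''y'' s)"
      using s4(2) z y by (simp add: V_def)
    show "wp I (Cond (RLess (RNat (Num 0)) (RCell ''d'' [])) (Copy ''y'' ''z'') Skip) Q s4"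
    proof (intro wp_Cond wp_Skip wp_Copy)
      fix s5
      assume less: "bval I s4 (RLess (RNat (Num 0)) (RCell ''d'' []))"
        and s5: "unchanged {''j'', ''y''} {} False s4 s5"
          "\<And>j. j \<in> {1..agents I} \<Longrightarrow> labelling ''y'' s5 j = labelling ''z'' s4 j"
      have "same s5" using same4 s5(1) by (rule same_trans) (auto simp: W_def)
      moreover have "V (labelling ''y'' s5) = V z"
        using s5(2) z by (metis V_def label_value_cong)
      ultimately show "Q s5"
        using final[of s5] less d by (simp add: same_def W_def z_def n_def x_def i_def)
    next
      assume "\<not> bval I s4 (RLess (RNat (Num 0)) (RCell ''d'' []))"
      then show "Q s4"
        using final[of s4] same4 d y by (simp add: same_def W_def z_def n_def x_def i_def)
    qed auto
  qed
  show ?thesis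
    unfolding Try_def
  proof (intro wp_Seq, rule wp_map[where y = "''r''" and F = "\<lambda>_. 1"], goal_cases)
    case (5 s' i)
    then show ?case by (intro wp_NAssign) (auto simp: set_cell_def)
  next
    case (6 s1)
    have same1: "same s1" using same_s 6(1) by (rule same_trans) (auto simp: W_def)
    have fl: "flags I s1 {1..agents I}" using 6(2) by (auto simp: flags_def)
    show ?case
    proof (rule wp_Seq, rule wp_Peel[OF l fl], goal_cases)
      case (1 s2)
      have same2: "same s2" using same1 1(1) by (rule same_trans) (auto simp: W_def)
      have R: "flags I s2 R"
        using 1(2) sameD[OF same1] by (simp add: R_def n_def i_def x_def labelling_def[abs_def])
      have y2: "nats s2 ''y'' = nats s ''y''" using 6(1) 1(1) by (simp add: unchanged_def)
      show ?case
      proof (rule wp_Seq, rule wp_map[where y = "''z''" and F = z], goal_cases)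
        case (5 s' j)
        have "nats s' ''r'' [j] = of_bool (j \<in> R)" "nats s' ''x'' = nats s ''x''"
          "nats s' ''i'' = nats s ''i''"
          using 5(1,2) R sameD[OF same2] by (simp_all add: flags_def unchanged_def)
        moreover have "z j = (if j \<in> R then nats s ''i'' [] else nats s ''x'' [j])"
          by (simp add: z_def candidate_def moved_def R_def i_def x_def labelling_def)
        ultimately show ?case
          using 5(3) by (intro wp_Cond wp_NAssign) (auto simp: set_cell_def)
      next
        case (6 s3)
        have "same s3" using same2 6(1) by (rule same_trans) (auto simp: W_def)
        moreover have "nats s3 ''y'' = nats s ''y''" using y2 6(1) by (simp add: unchanged_def)
        ultimately show ?case
          using 6(2) by (intro *) (simp_all add: labelling_def n_def)
      qed auto
    qed
  qed auto
qed

lemma Round_written: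
  "nats_written Round = {''a'', ''i'', ''j'', ''k'', ''r'', ''x'', ''y'', ''z''}"
  "reals_written Round = {''d'', ''e''}" "\<not> gives Round"
  by (auto simp: Round_def For_written Try_written Copy_written)

lemma wp_Round:
  fixes I s
  defines "V \<equiv> label_value (agents I) (lin_weight I)" and "m \<equiv> items I"
  assumes final: "\<And>s'. V (labelling ''x'' s) \<le> V (labelling ''x'' s') \<Longrightarrow>
      (\<And>i l. i \<in> {1..m} \<Longrightarrow> l \<in> {2, 2 - 1 / real m} \<Longrightarrow>
        V (candidate (agents I) (lin_weight I) (labelling ''x'' s) i l) \<le> V (labelling ''x'' s')) \<Longrightarrow> Q s'"
  shows "wp I Round Q s"
proof -
  define x where "x = labelling ''x'' s"
  define C where "C i l = V (candidate (agents I) (lin_weight I) x i l)" for i l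
  define Inv where "Inv i s' \<longleftrightarrow> labelling ''x'' s' = x \<and> V x \<le> V (labelling ''y'' s') \<and>
    (\<forall>i'\<in>{1..i}. \<forall>l\<in>{2, 2 - 1 / real m}. C i' l \<le> V (labelling ''y'' s'))" for i s'
  show ?thesis
    unfolding Round_def
  proof (intro wp_Seq wp_Copy, goal_cases)
    case (4 s1)
    have x1: "labelling ''x'' s1 = x"
      using 4(1) by (simp add: unchanged_def labelling_def[abs_def] x_def)
    have y1: "V (labelling ''y'' s1) = V x"
      using 4(2) unfolding V_def x_def by (rule label_value_cong)
    show ?case
    proof (rule wp_For[where Inv = Inv], goal_cases)
      case 3
      have "labelling v (s1\<lparr>nats := set_cell (nats s1) ''i'' [] 0\<rparr>) = labelling v s1"
        if "v \<noteq> ''i''" for v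
        using that by (simp add: labelling_def[abs_def] set_cell_def)
      then show ?case using x1 y1 by (simp add: Inv_def)
    next
      case (4 i s2)
      let ?s = "s2\<lparr>nats := set_cell (nats s2) ''i'' [] (Suc i)\<rparr>"
      have s: "labelling ''x'' ?s = x" "labelling ''y'' ?s = labelling ''y'' s2" "nats ?s ''i'' [] = Suc i"
        using 4(2) by (auto simp: labelling_def[abs_def] set_cell_def Inv_def)
      show ?case
      proof (intro wp_Seq, rule wp_Try[where c = 2], goal_cases)
        case (2 s3)
        have s3: "labelling ''x'' s3 = x" "nats s3 ''i'' [] = Suc i"
          using 2(1) s by (auto simp: labelling_def[abs_def] unchanged_def)
        show ?case
        proof (rule wp_Try[where c = "2 - 1 / real m"], goal_cases)
          case (2 s4)
          have "labelling ''x'' s4 = x"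
            using 2(1) s3 by (auto simp: labelling_def[abs_def] unchanged_def)
          moreover have "V (labelling ''y'' s2) \<le> V (labelling ''y'' s4)"
            "C (Suc i) 2 \<le> V (labelling ''y'' s4)" "C (Suc i) (2 - 1 / real m) \<le> V (labelling ''y'' s4)"
            using 2(2,3) \<open>label_value _ _ (labelling ''y'' ?s) \<le> _\<close>
              \<open>label_value _ _ (candidate _ _ (labelling ''x'' ?s) _ _) \<le> _\<close> s s3
            by (auto simp: C_def V_def)
          moreover have "C i' l \<le> V (labelling ''y'' s2)"
            if "i' \<in> {1..Suc i}" "i' \<noteq> Suc i" "l \<in> {2, 2 - 1 / real m}" for i' l
            using 4(2) that by (auto simp: Inv_def)
          moreover have "V x \<le> V (labelling ''y'' s2)" using 4(2) by (simp add: Inv_def)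
          ultimately show ?case
            unfolding Inv_def by (metis insertE order_trans singletonD)
        qed (simp add: m_def)
      qed simp
    next
      case (5 s2)
      show ?case
      proof (intro wp_Copy, goal_cases)
        case (4 s3)
        have "V (labelling ''x'' s3) = V (labelling ''y'' s2)"
          using 4(2) unfolding V_def by (rule label_value_cong)
        moreover have "V x \<le> V (labelling ''y'' s2)"
          "\<And>i l. i \<in> {1..m} \<Longrightarrow> l \<in> {2, 2 - 1 / real m} \<Longrightarrow> C i l \<le> V (labelling ''y'' s2)"
          using 5 by (auto simp: Inv_def m_def)
        ultimately show ?case
          by (intro final) (simp_all add: C_def x_def)
      qed auto
    qed (auto simp: Try_written)
  qed auto
qed

section \<open>Quadratically many rounds suffice\<close>

lemma wp_Local_search:
  fixes I
  defines "V \<equiv> label_value (agents I) (lin_weight I)" and "m \<equiv> items I"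
  assumes m: "1 \<le> m" and nonneg: "\<And>i j k. 0 \<le> lin_weight I i j k"
  shows "wp I Local_search (\<lambda>s. \<exists>x. (\<forall>i. alloc s i = {j \<in> {1..agents I}. x j = i}) \<and>
    (\<forall>S. (\<forall>i\<in>{1..m}. S i \<subseteq> {1..agents I}) \<longrightarrow> disjoint_family_on S {1..m} \<longrightarrow>
      packing_value m (lin_weight I) S \<le> 4 * V x)) initial_state"
proof -
  \<comment> \<open>\<open>opt\<close> admits the value of every packing, not only the largest, so
    the bound is proved for all of them without choosing an optimum.\<close>
  define opt where "opt A \<longleftrightarrow> (\<exists>S. (\<forall>i\<in>{1..m}. S i \<subseteq> {1..agents I}) \<and> disjoint_family_on S {1..m} \<and>
    A = packing_value m (lin_weight I) S)" for A
  \<comment> \<open>The second alternative says that \<open>t\<close> rounds have accumulated at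
    least \<open>t\<close> times \<open>A / (2 * m)\<^sup>2\<close>, the gain guaranteed while
    \<open>4 * V x < A\<close>.\<close>
  define reached where "reached t x \<longleftrightarrow> 0 \<le> V x \<and>
    (\<forall>A. opt A \<longrightarrow> A \<le> 4 * V x \<or> real t * A \<le> (2 * real m)\<^sup>2 * V x)" for t x
  have V_nonneg: "0 \<le> V x" for x
    unfolding V_def label_value_def pair_weight_def class_weight_def
    by (intro sum_nonneg mult_nonneg_nonneg nonneg) auto
  have step: "reached (Suc t) x'" if t: "reached t x" and up: "V x \<le> V x'"
    and best: "\<And>i l. i \<in> {1..m} \<Longrightarrow> l \<in> {2, 2 - 1 / real m} \<Longrightarrow>
        V (candidate (agents I) (lin_weight I) x i l) \<le> V x'" for t x x'
    unfolding reached_def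
  proof (intro conjI allI impI V_nonneg)
    fix A assume A: "opt A"
    then obtain S where S: "\<And>i. i \<in> {1..m} \<Longrightarrow> S i \<subseteq> {1..agents I}" "disjoint_family_on S {1..m}"
      "A = packing_value m (lin_weight I) S"
      unfolding opt_def by blast
    have "A \<le> real m * (V x' - V x) + (4 - 1 / real m) * V x"
      unfolding S(3) V_def by (rule local_search_step[OF m S(1,2) nonneg best[unfolded V_def]])
    then have "real m * A \<le> real m * (real m * (V x' - V x) + (4 - 1 / real m) * V x)"
      by (intro mult_left_mono) auto
    then have gain: "real m * A \<le> (real m)\<^sup>2 * (V x' - V x) + (4 * real m - 1) * V x"
      using m by (simp add: algebra_simps power2_eq_square)
    show "A \<le> 4 * V x' \<or> real (Suc t) * A \<le> (2 * real m)\<^sup>2 * V x'"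
    proof (cases "A \<le> 4 * V x")
      case True
      then show ?thesis using up by simp
    next
      case False
      \<comment> \<open>Replacing \<open>V x\<close> by the larger \<open>A / 4\<close> makes the
        terms \<open>m * A\<close> cancel in \<open>gain\<close>, which leaves
        \<open>A / 4 \<le> m\<^sup>2 * (V x' - V x)\<close>.\<close>
      have "(4 * real m - 1) * V x \<le> (4 * real m - 1) * (A / 4)"
        using False m by (intro mult_left_mono) auto
      with gain have "A \<le> (2 * real m)\<^sup>2 * (V x' - V x)"
        by (simp add: algebra_simps power2_eq_square)
      moreover have "real t * A \<le> (2 * real m)\<^sup>2 * V x"
        using t A False unfolding reached_def by blast
      ultimately show ?thesis by (simp add: algebra_simps)
    qed
  qed
  show ?thesis
    unfolding Local_search_def
  proof (intro wp_Seq, rule wp_For[where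
      Inv = "\<lambda>a s. alloc s = (\<lambda>_. {}) \<and> reached (a * m) (labelling ''x'' s)"], goal_cases)
    case 3
    show ?case
      using V_nonneg by (auto simp: initial_state_def reached_def)
  next
    case (4 a s)
    have lab: "labelling ''x'' (s\<lparr>nats := set_cell (nats s) v [] k\<rparr>) = labelling ''x'' s"
      if "v \<noteq> ''x''" for s v k
      using that by (simp add: labelling_def[abs_def] set_cell_def)
    show ?case
    proof (rule wp_For[where
        Inv = "\<lambda>b s. alloc s = (\<lambda>_. {}) \<and> reached (a * m + b) (labelling ''x'' s)"], goal_cases)
      case 3
      then show ?case using 4 by (simp add: labelling_def[abs_def] set_cell_def)
    next
      case (4 b s1)
      let ?s = "s1\<lparr>nats := set_cell (nats s1) ''t'' [] (Suc b)\<rparr>"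
      have "wp I Round (\<lambda>s'. reached (a * m + Suc b) (labelling ''x'' s')) ?s"
      proof (rule wp_Round, goal_cases)
        case (1 s')
        then show ?case
          using step[of "a * m + b" "labelling ''x'' s1" "labelling ''x'' s'"] 4
          by (auto simp: lab V_def m_def)
      qed
      then show ?case
        by (rule wp_conseq) (use 4 in \<open>auto simp: unchanged_def Round_written\<close>)
    next
      case (5 s1)
      then show ?case by (simp add: m_def add.commute)
    qed (auto simp: Round_written)
  next
    case (5 s)
    define x where "x = labelling ''x'' s"
    have reached: "reached (m * m) x" using 5 by (simp add: m_def x_def)
    \<comment> \<open>At \<open>t = m * m\<close> the second alternative of \<open>reached\<close>
      becomes the first after division by \<open>m * m\<close>.\<close>
    have bound: "A \<le> 4 * V x" if "opt A" for A
    proof -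
      have "A \<le> 4 * V x \<or> real (m * m) * A \<le> (2 * real m)\<^sup>2 * V x"
        using reached that unfolding reached_def by blast
      moreover have "real (m * m) * A \<le> (2 * real m)\<^sup>2 * V x \<longleftrightarrow> real (m * m) * A \<le> real (m * m) * (4 * V x)"
        by (simp add: power2_eq_square mult_ac)
      ultimately show ?thesis using m by (simp only:) (auto simp: mult_le_cancel_left)
    qed
    show ?case
    proof (rule wp_For[where Inv = "\<lambda>k s'. nats s' ''x'' = nats s ''x'' \<and>
        (\<forall>i. alloc s' i = {j \<in> {1..k}. x j = i})"], goal_cases)
      case (4 k s')
      then show ?case
        by (intro wp_Give) (auto simp: set_cell_def x_def labelling_def le_Suc_eq)
    next
      case (5 s')
      show ?case
      proof (intro exI[of _ x] conjI allI impI)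
        fix S assume "\<forall>i\<in>{1..m}. S i \<subseteq> {1..agents I}" "disjoint_family_on S {1..m}"
        then show "packing_value m (lin_weight I) S \<le> 4 * V x"
          using bound unfolding opt_def by blast
      qed (use 5 in simp)
    qed (use 5 in \<open>auto simp: set_cell_def\<close>)
  qed (auto simp: For_written Round_written)
qed

section \<open>Reduction to pair weights\<close>

text \<open>The random variable is 1 with probability \<open>y\<close> and 0 otherwise. Its mean is
  \<open>y\<close>, and the mean of \<open>g\<close> is \<open>y * g 1\<close> because
  \<open>g 0 = 0\<close>.\<close>

lemma ratio_le_jensen_ratio:
  assumes g: "g 0 = 0" and y: "y \<in> {0..1}"
  shows "ratio (g y) (y * g 1) \<le> jensen_ratio g"
proof -
  define M :: "real measure" where "M = measure_pmf (map_pmf of_bool (bernoulli_pmf y))"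
  \<comment> \<open>The sample space is all of the reals, on which the identity would leave
    \<open>{0..1}\<close>; the indicator of 1 agrees with it on the support.\<close>
  define X :: "real \<Rightarrow> real" where "X \<omega> = of_bool (\<omega> = 1)" for \<omega>
  have "integral\<^sup>L M (\<lambda>\<omega>. h (X \<omega>)) = y * h 1 + (1 - y) * h 0" for h :: "real \<Rightarrow> real"
    using y by (simp add: M_def X_def)
  from this[of id] this[of g]
  have "ratio (g y) (y * g 1) = ratio (g (integral\<^sup>L M X)) (integral\<^sup>L M (\<lambda>\<omega>. g (X \<omega>)))"
    by (simp add: g)
  moreover have "prob_space M" "X \<in> borel_measurable M" "X \<in> space M \<rightarrow> {0..1}"
    by (simp_all add: M_def X_def measure_pmf.prob_space_axioms)
  ultimately show ?thesis unfolding jensen_ratio_def by (intro Sup_upper) blast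
qed

text \<open>The variable that is constantly 0 gives 0/0, which is read as 1.\<close>

lemma jensen_ratio_ge_1:
  assumes "g 0 = 0"
  shows "1 \<le> jensen_ratio g"
  using ratio_le_jensen_ratio[of g 0] assms by (simp add: ratio_def)

lemma jensen_ratio_linear:
  assumes mono: "mono_on {0..1} g" and g: "g \<in> {0..1} \<rightarrow> {0..}" "g 0 = 0" and x: "x \<in> {0..1}"
  shows "ereal (g x) \<le> ereal (x * g 1) * jensen_ratio g"
proof -
  have bounds: "0 \<le> g x" "g x \<le> g 1" using g x mono by (auto simp: Pi_iff mono_on_def)
  show "ereal (g x) \<le> ereal (x * g 1) * jensen_ratio g"
  proof (cases "x * g 1 = 0")
    \<comment> \<open>Either \<open>x = 0\<close> or \<open>g 1 = 0\<close>, and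
      \<open>g x = 0\<close> in both cases, in the second by monotonicity. The right-hand side is 0
      even for an infinite ratio, as zero times infinity is 0.\<close>
    case True
    then have "g x = 0" using bounds g(2) by auto
    then show ?thesis unfolding True by (simp add: zero_ereal_def[symmetric])
  next
    case False
    then have "0 < x * g 1" using x bounds by auto
    moreover have "ereal (g x) / ereal (x * g 1) \<le> jensen_ratio g"
      using ratio_le_jensen_ratio[of g x, OF g(2) x] False by (auto simp: ratio_def split: if_splits)
    ultimately show ?thesis by (subst (asm) ereal_divide_le_pos) auto
  qed
qed

lemma jensen_ratio_le_beta:
  assumes "i \<in> {1..items I}" "j \<in> {1..agents I}"
  shows "jensen_ratio (ext I i j) \<le> beta I"
  unfolding beta_def
proof (rule Max_ge)
  show "finite {jensen_ratio (ext I i j) |i j. i \<in> {1..items I} \<and> j \<in> {1..agents I}}"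
    by (rule finite_image_set2) auto
qed (use assms in auto)

lemma lin_weight_nonneg:
  assumes "valid_instance I"
  shows "0 \<le> lin_weight I i j k"
  using assms unfolding valid_instance_def lin_weight_def ext_query_def weight_query_def
  by (auto simp: Pi_iff)

section \<open>Welfare against linearized pair weights\<close>

context
  fixes I :: msw_instance and S :: "nat \<Rightarrow> nat set"
  assumes valid: "valid_instance I" and feasible: "feasible I S"
begin

lemma packing_value_lin_weight:
  "packing_value (items I) (lin_weight I) S
    = (\<Sum>i\<in>{1..items I}. \<Sum>j\<in>S i. (\<Sum>k\<in>S i. weight I i j k) * ext I i j 1)"
  unfolding packing_value_def pair_weight_def
proof (intro sum.cong refl)
  fix i j assume ij: "i \<in> {1..items I}" "j \<in> S i"
  have "lin_weight I i j k = weight I i j k * ext I i j 1" if "k \<in> S i" for k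
  proof -
    have "S i \<subseteq> {1..agents I}" using feasible ij(1) unfolding feasible_def by blast
    then show ?thesis using ij that by (auto simp: lin_weight_def ext_query_def weight_query_def)
  qed
  then show "(\<Sum>k\<in>S i. lin_weight I i j k) = (\<Sum>k\<in>S i. weight I i j k) * ext I i j 1"
    by (simp add: sum_distrib_right)
qed

lemma feasible_member:
  assumes i: "i \<in> {1..items I}" and j: "j \<in> S i"
  shows "j \<in> {1..agents I}" "(\<Sum>k\<in>S i. weight I i j k) \<in> {0..1}"
    "mono_on {0..1} (ext I i j)" "ext I i j \<in> {0..1} \<rightarrow> {0..}" "ext I i j 0 = 0"
    "concave_on {0..1} (ext I i j)"
proof -
  have S: "S i \<subseteq> {1..agents I}" using feasible i unfolding feasible_def by blast
  then show j': "j \<in> {1..agents I}" using j by blast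
  have v: "(\<forall>k\<in>{1..agents I}. 0 \<le> weight I i j k) \<and> (\<Sum>k\<in>{1..agents I}. weight I i j k) = 1 \<and>
      ext I i j \<in> {0..1} \<rightarrow> {0..} \<and> mono_on {0..1} (ext I i j) \<and>
      concave_on {0..1} (ext I i j) \<and> ext I i j 0 = 0"
    using valid i j' unfolding valid_instance_def by blast
  then show "mono_on {0..1} (ext I i j)" "ext I i j \<in> {0..1} \<rightarrow> {0..}" "ext I i j 0 = 0"
    "concave_on {0..1} (ext I i j)" by blast+
  have "(\<Sum>k\<in>S i. weight I i j k) \<le> (\<Sum>k\<in>{1..agents I}. weight I i j k)"
    using S v by (intro sum_mono2) auto
  moreover have "0 \<le> (\<Sum>k\<in>S i. weight I i j k)" using S v by (intro sum_nonneg) auto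
  ultimately show "(\<Sum>k\<in>S i. weight I i j k) \<in> {0..1}" using v by simp
qed

lemma packing_value_le_welfare: "packing_value (items I) (lin_weight I) S \<le> welfare I S"
  unfolding packing_value_lin_weight welfare_def
proof (intro sum_mono)
  fix i j assume ij: "i \<in> {1..items I}" "j \<in> S i"
  let ?a = "\<Sum>k\<in>S i. weight I i j k"
  show "?a * ext I i j 1 \<le> ext I i j ?a"
    using concave_onD[OF feasible_member(6)[OF ij], of ?a 0 1] feasible_member(2,5)[OF ij] by simp
qed

lemma welfare_le_packing_value:
  assumes b: "beta I = ereal b"
  shows "welfare I S \<le> b * packing_value (items I) (lin_weight I) S"
proof -
  have "ext I i j (\<Sum>k\<in>S i. weight I i j k) \<le> b * ((\<Sum>k\<in>S i. weight I i j k) * ext I i j 1)"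
    if ij: "i \<in> {1..items I}" "j \<in> S i" for i j
  proof -
    let ?a = "\<Sum>k\<in>S i. weight I i j k"
    note m = feasible_member[OF ij]
    have "ereal (ext I i j ?a) \<le> ereal (?a * ext I i j 1) * jensen_ratio (ext I i j)"
      using m by (intro jensen_ratio_linear) auto
    also have "\<dots> \<le> ereal (?a * ext I i j 1) * beta I"
      using m(2,4) jensen_ratio_le_beta[OF ij(1) m(1)]
      by (intro ereal_mult_left_mono) (auto simp: Pi_iff)
    finally show ?thesis by (simp add: b mult.commute)
  qed
  then show ?thesis
    unfolding packing_value_lin_weight welfare_def sum_distrib_left by (intro sum_mono)
qed

end

text \<open>Excludes the value minus infinity and justifies multiplying and dividing by a finite
  \<open>beta I\<close>.\<close>

lemma one_le_beta:
  assumes "valid_instance I"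
  shows "1 \<le> beta I"
proof -
  have "1 \<in> {1..items I}" "1 \<in> {1..agents I}" using assms by (auto simp: valid_instance_def)
  moreover from this have "1 \<le> jensen_ratio (ext I 1 1)"
    using assms unfolding valid_instance_def by (intro jensen_ratio_ge_1) auto
  ultimately show ?thesis using jensen_ratio_le_beta order_trans by blast
qed

text \<open>Pairs are grouped by their common label; labels that are not items contribute 0 on the
  left, where the weights vanish.\<close>

lemma label_value_eq_packing_value:
  "label_value (agents I) (lin_weight I) x
    = packing_value (items I) (lin_weight I) (\<lambda>i. {j \<in> {1..agents I}. x j = i})"
proof -
  let ?N = "{1..agents I}" and ?M = "{1..items I}" and ?w = "lin_weight I"
  have outside: "?w i j k = 0" if "i \<notin> ?M" for i j k
    using that by (auto simp: lin_weight_def weight_query_def)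
  have "packing_value (items I) ?w (\<lambda>i. {j \<in> ?N. x j = i})
      = (\<Sum>i\<in>?M. \<Sum>j\<in>?N. if x j = i then \<Sum>k\<in>?N. class_weight ?w x j k else 0)"
    unfolding packing_value_def pair_weight_def
    by (simp only: sum.inter_filter[OF finite_atLeastAtMost], intro sum.cong refl if_cong)
      (auto simp: class_weight_def)
  also have "\<dots> = (\<Sum>j\<in>?N. \<Sum>i\<in>?M. if x j = i then \<Sum>k\<in>?N. class_weight ?w x j k else 0)"
    by (rule sum.swap)
  also have "\<dots> = label_value (agents I) ?w x"
    unfolding label_value_def pair_weight_def
  proof (rule sum.cong)
    fix j
    show "(\<Sum>i\<in>?M. if x j = i then \<Sum>k\<in>?N. class_weight ?w x j k else 0)
        = (\<Sum>k\<in>?N. class_weight ?w x j k)"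
      using outside[of "x j"] by (cases "x j \<in> ?M") (simp_all add: sum.delta class_weight_def)
  qed simp
  finally show ?thesis by simp
qed

theorem proposition4:
  shows "\<exists>P. approximation_algorithm (\<lambda>I. 4 * beta I) P"
proof -
  obtain p where p: "\<And>K. cost K Local_search = poly p K" using cost_poly by blast
  have "approximation_algorithm (\<lambda>I. 4 * beta I) Local_search"
    unfolding approximation_algorithm_def Let_def
  proof (intro exI[of _ p] allI impI, goal_cases)
    case (1 I)
    define V where "V = label_value (agents I) (lin_weight I)"
    define r where "r = run I Local_search (poly p (agents I + items I))"
    have m: "1 \<le> items I" using 1 by (simp add: valid_instance_def)
    obtain s x where s: "terminates_in I (poly p (agents I + items I)) Local_search initial_state s"
      and alloc: "\<And>i. alloc s i = {j \<in> {1..agents I}. x j = i}"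
      and opt: "\<And>S. feasible I S \<Longrightarrow> packing_value (items I) (lin_weight I) S \<le> 4 * V x"
      using wp_Local_search[OF m lin_weight_nonneg[OF 1]]
      unfolding wp_def p V_def feasible_def by auto
    \<comment> \<open>The search flips no coins: the distribution is a point mass, and the expected
      welfare is the welfare at \<open>s\<close>.\<close>
    have r: "r = return_pmf (Skip, s)"
      using s by (simp add: r_def run_def terminates_in_def set_pmf_subset_singleton)
    have feasible: "feasible I (alloc s)"
      by (auto simp: feasible_def disjoint_family_on_def alloc)
    have "alloc s = (\<lambda>i. {j \<in> {1..agents I}. x j = i})" using alloc by blast
    then have V: "V x \<le> welfare I (alloc s)"
      using packing_value_le_welfare[OF 1 feasible] by (simp add: V_def label_value_eq_packing_value)
    obtain S where S: "feasible I S" "max_welfare I = welfare I S"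
      using Max_in[OF finite_feasible_welfare feasible_welfare_nonempty, of I]
      unfolding max_welfare_def by blast
    have V0: "0 \<le> V x"
      unfolding V_def label_value_def pair_weight_def class_weight_def
      using lin_weight_nonneg[OF 1] by (intro sum_nonneg) simp
    have "1 / (4 * beta I) * ereal (max_welfare I) \<le> ereal (welfare I (alloc s))"
    proof (cases "beta I")
      case (real b)
      then have b: "1 \<le> b" using one_le_beta[OF 1] by simp
      have "max_welfare I \<le> b * packing_value (items I) (lin_weight I) S"
        unfolding S(2) by (rule welfare_le_packing_value[OF 1 S(1) real])
      also have "\<dots> \<le> b * (4 * welfare I (alloc s))"
        using opt[OF S(1)] V b by (intro mult_left_mono) auto
      finally have "max_welfare I / (4 * b) \<le> welfare I (alloc s)"
        using b by (simp add: field_simps)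
      then show ?thesis using b by (simp add: real one_ereal_def)
    next
      \<comment> \<open>The factor \<open>1 / (4 * beta I)\<close> is 0, so only nonnegativity of
        the welfare is left, which follows from \<open>V0\<close> and \<open>V\<close>.\<close>
      case PInf
      then show ?thesis using V V0 by simp
    next
      case MInf
      then show ?thesis using one_le_beta[OF 1] by simp
    qed
    then show ?case
      using feasible unfolding r_def[symmetric] halts_within_def by (simp add: r r_def[symmetric])
  qed
  then show ?thesis by blast
qed

end
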